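(* Let $k\ge0$ and $\mathbf n=(n_1,\dots,n_r)$ with $1=n_1=\dots=n_s<n_{s+1}\le\dots\le n_r$ (where $0\le s\le r$). Then \[ \delta_{pr}(k,\mathbf n)\le\begin{cases}2(k+r)-s-t & \text{if } 3s\le 2k+2r,\\ 2(k+r-s)+1 & \text{if } 3s=2k+2r+1,\\ 2(k+r-s+1) & \text{if } 3s\ge 2k+2r+2,\end{cases} \] where, in the first case, $t\in\{s,\dots,r\}$ is maximal such that $3s+\sum_{i=s+1}^t(n_i+1)\le 2k+2r$.
   Context: $\Delta_m$ denotes the $m$-dimensional simplex; for $\mathbf n=(n_1,\dots,n_r)$, $\Delta_{\mathbf n}:=\Delta_{n_1}\times\dots\times\Delta_{n_r}$. The $k$-skeleton of a polytope is the poset of its faces of dimension at most $k$; two $k$-skeleta are combinatorially equivalent if these posets are isomorphic. A convex polytope is $(k,\mathbf n)$-PSN if its $k$-skeleton is combinatorially equivalent to that of $\Delta_{\mathbf n}$, and $(k,\mathbf n)$-PPSN if in addition it is the image under a linear projection of a polytope combinatorially equivalent to $\Delta_{\mathbf n}$. $\delta_{pr}(k,\mathbf n)$ is the smallest dimension of a $(k,\mathbf n)$-PPSN polytope. *)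

theory Defs
  imports "HOL-Analysis.Analysis" "HOL-Analysis.Finite_Function_Topology"
begin

text \<open>Ambient space: finitely supported real sequences, i.e. the union of all R^N.
  Every polytope lives in a finite-dimensional subspace, and linear projections
  between Euclidean spaces are linear maps of this space.\<close>

type_synonym vspace = "nat \<Rightarrow>\<^sub>0 real"

definition pdim :: "vspace set \<Rightarrow> int" where
  "pdim F = (if F = {} then -1 else int (dim {x - y | x y. x \<in> F \<and> y \<in> F}))"

definition block_off :: "nat list \<Rightarrow> nat \<Rightarrow> nat" where
  "block_off ns i = sum_list (map Suc (take i ns))"

text \<open>The product of simplices Delta_{n_1} x ... x Delta_{n_r} in standard coordinates:
  the i-th factor Delta_{n_i} is the standard simplex in the block of n_i+1 coordinates
  starting at block_off ns i.\<close>
definition prod_simplex :: "nat list \<Rightarrow> vspace set" where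
  "prod_simplex ns = {x. (\<forall>j. 0 \<le> Poly_Mapping.lookup x j)
      \<and> Poly_Mapping.keys x \<subseteq> {0..<sum_list (map Suc ns)}
      \<and> (\<forall>i<length ns. (\<Sum>j\<in>{block_off ns i..<block_off ns (Suc i)}. Poly_Mapping.lookup x j) = 1)}"

definition poset_iso :: "'a set set \<Rightarrow> 'b set set \<Rightarrow> bool" where
  "poset_iso A B \<longleftrightarrow> (\<exists>f. bij_betw f A B \<and> (\<forall>F\<in>A. \<forall>G\<in>A. F \<subseteq> G \<longleftrightarrow> f F \<subseteq> f G))"

definition skeleton :: "nat \<Rightarrow> vspace set \<Rightarrow> vspace set set" where
  "skeleton k P = {F. F face_of P \<and> pdim F \<le> int k}"

definition comb_equiv :: "vspace set \<Rightarrow> vspace set \<Rightarrow> bool" where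
  "comb_equiv P Q \<longleftrightarrow> poset_iso {F. F face_of P} {F. F face_of Q}"

definition PSN :: "nat \<Rightarrow> nat list \<Rightarrow> vspace set \<Rightarrow> bool" where
  "PSN k ns P \<longleftrightarrow> polytope P \<and> poset_iso (skeleton k P) (skeleton k (prod_simplex ns))"

definition PPSN :: "nat \<Rightarrow> nat list \<Rightarrow> vspace set \<Rightarrow> bool" where
  "PPSN k ns P \<longleftrightarrow> PSN k ns P \<and>
     (\<exists>Q f. polytope Q \<and> comb_equiv Q (prod_simplex ns) \<and> linear f \<and> P = f ` Q)"

definition delta_pr :: "nat \<Rightarrow> nat list \<Rightarrow> nat" where
  "delta_pr k ns = (LEAST d. \<exists>P. PPSN k ns P \<and> pdim P = int d)"

end

theory Submission
  imports Defs
begin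

text \<open>
  A deformed product of simplices is described in slack coordinates: all coordinates are
  nonnegative and each block has a prescribed sum, which may depend affinely on the later blocks.
  Its nonempty faces correspond to the coordinate sets that meet every block. For a linear
  projection to preserve the k-skeleton it is enough that each such set A with at most k + r
  elements is the zero set of a nonnegative functional that, up to a constant, factors through
  the projection. Then the target needs only one dimension per functional used.

  The functionals are built from Q(t) = prod (t - a)^2, a in A, evaluated at points attached to
  the coordinates. The two coordinates of a segment share a point and are told apart by their
  difference, so a segment contributes to A only if the face contains it. If at most
  2(k + r - s) + 1 points lie outside the large blocks, interpolation yields capacities for which
  one combination of moments per small block is constant on the polytope. If there are more
  segments, they are chained: each capacity is governed by the difference coordinate of
  the next segment, which makes the differences affine in the segment sums, and Q is perturbed to
  absorb the resulting error.
\<close>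

text \<open>Put m = 2(k + r - s). A segment takes one element of A before a second one turns its
  point into a zero, so A asks for at most k + r - s zeros and the squared polynomial has degree at
  most m: m + 1 moments and s differences suffice. The bounds come from what can be saved. Let N be
  the number of points outside the large blocks. If N is at most m + 1, the Lagrange polynomials of
  these points are available; those of one small block add up to a functional that is constant on
  the polytope, which saves t functionals. If N is at most m, the polynomial of degree N with these
  N roots also becomes constant, by a choice of weights, and s + m + 1 - t - 1 = 2(k + r) - s - t
  remain. The three cases of the theorem are s <= m, s = m + 1 and s >= m + 2, and t is maximal with
  N <= m. In the last case s differences are too expensive; the chain keeps only the first of them
  besides the m + 1 moments. The price: eliminating a difference changes the values on the preceding
  segment, and this is the error to be absorbed.\<close>

abbreviation crd :: "vspace \<Rightarrow> nat \<Rightarrow> real" where "crd \<equiv> Poly_Mapping.lookup"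
abbreviation supp :: "vspace \<Rightarrow> nat set" where "supp \<equiv> Poly_Mapping.keys"

lemma lookup_scaleR [simp]:
  fixes x :: "'a \<Rightarrow>\<^sub>0 'b::real_vector"
  shows "Poly_Mapping.lookup (r *\<^sub>R x) i = r *\<^sub>R Poly_Mapping.lookup x i"
proof -
  have "finite {i. r *\<^sub>R Poly_Mapping.lookup x i \<noteq> 0}"
    by (rule finite_subset[OF _ finite_lookup[of x]]) auto
  then show ?thesis by (simp add: scaleR_poly_mapping_def)
qed

lemma linear_crd: "linear (\<lambda>z. crd z a)"
  by (rule linearI) (simp_all add: lookup_add)

section \<open>Dimension\<close>

lemma pdim_le_card:
  assumes "{x - y |x y. x \<in> F \<and> y \<in> F} \<subseteq> span W" "finite W"
  shows "pdim F \<le> int (card W)"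
  using dim_le_card[OF assms] by (simp add: pdim_def)

text \<open>The functional kills every direction of \<open>F\<close> but not the direction
  \<open>y - x0\<close> of \<open>G\<close>, so a basis for \<open>F\<close> gains a vector. The
  finite \<open>W\<close> guards against infinite bases, whose \<open>card\<close> would be
  0.\<close>

lemma pdim_less:
  fixes g :: "vspace \<Rightarrow> real"
  assumes FG: "F \<subseteq> G" and ne: "F \<noteq> {}" and g: "linear g"
    and Fc: "\<And>x. x \<in> F \<Longrightarrow> g x = c" and y: "y \<in> G" "g y \<noteq> c"
    and W: "{x - y |x y. x \<in> G \<and> y \<in> G} \<subseteq> span W" "finite W"
  shows "pdim F < pdim G"
proof -
  let ?DF = "{x - y |x y. x \<in> F \<and> y \<in> F}" and ?DG = "{x - y |x y. x \<in> G \<and> y \<in> G}"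
  have sub: "?DF \<subseteq> ?DG" using FG by auto
  obtain B where B: "B \<subseteq> ?DF" "independent B" "?DF \<subseteq> span B" "card B = dim ?DF"
    by (rule basis_exists)
  obtain C where C: "C \<subseteq> ?DG" "independent C" "?DG \<subseteq> span C" "card C = dim ?DG"
    by (rule basis_exists)
  have finB: "finite B" and finC: "finite C"
    using independent_span_bound[OF W(2)] B(1,2) C(1,2) W(1) sub by auto
  obtain x0 where x0: "x0 \<in> F" using ne by auto
  have ker: "span B \<subseteq> {x. g x = 0}"
  proof (rule span_minimal)
    show "B \<subseteq> {x. g x = 0}" using B(1) Fc by (force simp: linear_diff[OF g])
    show "subspace {x. g x = 0}"
      by (auto simp: subspace_def linear_0[OF g] linear_add[OF g] linear_scale[OF g])
  qed
  have v: "y - x0 \<notin> span B" using ker y(2) Fc[OF x0] by (auto simp: linear_diff[OF g])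
  have "independent (insert (y - x0) B)" using v B(2) by (simp add: independent_insert)
  moreover have "insert (y - x0) B \<subseteq> span C" using C(3) B(1) sub y(1) x0 FG by blast
  ultimately have "card (insert (y - x0) B) \<le> card C"
    using independent_span_bound[OF finC] by blast
  moreover have "y - x0 \<notin> B" using v span_base by blast
  ultimately have "dim ?DF < dim ?DG" using B(4) C(4) finB by simp
  then show ?thesis using ne FG by (auto simp: pdim_def)
qed

text \<open>Each functional cuts \<open>U\<close> down by codimension at most 1, and after all of
  \<open>T\<close> only 0 is left; one vector per drop spans \<open>U\<close>.\<close>

lemma finite_spanning_of_separating:
  fixes \<phi> :: "'i \<Rightarrow> 'a::real_vector \<Rightarrow> real"
  assumes "finite T" "\<And>i. i \<in> T \<Longrightarrow> linear (\<phi> i)" "subspace U"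
    and "\<And>d. d \<in> U \<Longrightarrow> (\<And>i. i \<in> T \<Longrightarrow> \<phi> i d = 0) \<Longrightarrow> d = 0"
  shows "\<exists>W. finite W \<and> card W \<le> card T \<and> U \<subseteq> span W"
  using assms
proof (induction T arbitrary: U rule: finite_induct)
  case empty
  then have "U \<subseteq> span {}" by auto
  then show ?case by (intro exI[of _ "{}"]) auto
next
  case (insert i T)
  have lin: "linear (\<phi> i)" using insert.prems(1) by blast
  let ?U = "{d \<in> U. \<phi> i d = 0}"
  have "subspace ?U" using insert.prems(2)
    by (auto simp: subspace_def linear_0[OF lin] linear_add[OF lin] linear_scale[OF lin])
  moreover have "d = 0" if "d \<in> ?U" "\<And>j. j \<in> T \<Longrightarrow> \<phi> j d = 0" for d
    using insert.prems(3)[of d] that by blast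
  ultimately obtain W where W: "finite W" "card W \<le> card T" "?U \<subseteq> span W"
    using insert.IH[of ?U] insert.prems(1) by (metis (no_types, lifting) insertI2)
  show ?case
  proof (cases "?U = U")
    case True
    then show ?thesis using W insert.hyps by (intro exI[of _ W]) auto
  next
    case False
    then obtain u where u: "u \<in> U" "\<phi> i u \<noteq> 0" by auto
    have "U \<subseteq> span (insert u W)"
    proof
      fix d assume d: "d \<in> U"
      let ?c = "\<phi> i d / \<phi> i u"
      have "d - ?c *\<^sub>R u \<in> ?U"
        using d u insert.prems(2)
        by (auto simp: linear_diff[OF lin] linear_scale[OF lin] subspace_diff subspace_scale)
      then have "d - ?c *\<^sub>R u \<in> span W" using W(3) by blast
      then show "d \<in> span (insert u W)" by (auto simp: span_insert)
    qed
    moreover have "card (insert u W) \<le> card (insert i T)"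
      using W insert.hyps by (simp add: card_insert_if)
    ultimately show ?thesis using W(1) by (intro exI[of _ "insert u W"]) auto
  qed
qed

section \<open>Deformed products of simplices\<close>

definition block :: "nat list \<Rightarrow> nat \<Rightarrow> nat set" where
  "block ns i = {block_off ns i..<block_off ns (Suc i)}"

abbreviation ncoords :: "nat list \<Rightarrow> nat" where
  "ncoords ns \<equiv> block_off ns (length ns)"

lemma block_off_0 [simp]: "block_off ns 0 = 0"
  by (simp add: block_off_def)

lemma block_off_Suc: "i < length ns \<Longrightarrow> block_off ns (Suc i) = block_off ns i + Suc (ns ! i)"
  by (simp add: block_off_def take_Suc_conv_app_nth)

lemma block_off_mono: "i \<le> j \<Longrightarrow> block_off ns i \<le> block_off ns j"
proof (induction j rule: dec_induct)
  case (step j)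
  have "block_off ns j \<le> block_off ns (Suc j)"
    by (cases "j < length ns") (auto simp: block_off_Suc, simp add: block_off_def)
  then show ?case using step by simp
qed simp

lemma block_below: "i < length ns \<Longrightarrow> a \<in> block ns i \<Longrightarrow> a < ncoords ns"
  using block_off_mono[of "Suc i" "length ns" ns] by (auto simp: block_def)

lemma finite_block [simp]: "finite (block ns i)"
  by (simp add: block_def)

lemma block_disjoint: "i < j \<Longrightarrow> a \<in> block ns i \<Longrightarrow> a \<in> block ns j \<Longrightarrow> False"
  using block_off_mono[of "Suc i" j ns] by (auto simp: block_def)

lemma block_unique: "a \<in> block ns i \<Longrightarrow> a \<in> block ns j \<Longrightarrow> i = j"
  using block_disjoint[of i j a ns] block_disjoint[of j i a ns] by (cases i j rule: linorder_cases) auto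

lemma ex_block: "a < block_off ns j \<Longrightarrow> \<exists>i<j. a \<in> block ns i"
proof (induction j)
  case (Suc j)
  then show ?case by (cases "a < block_off ns j") (auto simp: block_def less_Suc_eq)
qed simp

definition transversals :: "nat list \<Rightarrow> nat set set" where
  "transversals ns = {A. A \<subseteq> {..<ncoords ns} \<and> (\<forall>i<length ns. A \<inter> block ns i \<noteq> {})}"

definition cap :: "nat list \<Rightarrow> (nat \<Rightarrow> real) \<Rightarrow> (nat \<Rightarrow> nat \<Rightarrow> real) \<Rightarrow> nat \<Rightarrow> vspace \<Rightarrow> real" where
  "cap ns \<beta> \<gamma> i z = \<beta> i + (\<Sum>a\<in>{block_off ns (Suc i)..<ncoords ns}. \<gamma> i a * crd z a)"

text \<open>Since a capacity looks only at later blocks, the system is triangular. The index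
  \<open>i\<close> allows it to be solved from the last block backwards, and lets positivity of a
  capacity be required for every partial solution.\<close>

definition solves_from ::
    "nat list \<Rightarrow> (nat \<Rightarrow> real) \<Rightarrow> (nat \<Rightarrow> nat \<Rightarrow> real) \<Rightarrow> nat \<Rightarrow> vspace \<Rightarrow> bool" where
  "solves_from ns \<beta> \<gamma> i z \<longleftrightarrow> (\<forall>a. 0 \<le> crd z a) \<and> supp z \<subseteq> {..<ncoords ns}
     \<and> (\<forall>j. i \<le> j \<and> j < length ns \<longrightarrow> (\<Sum>a\<in>block ns j. crd z a) = cap ns \<beta> \<gamma> j z)"

text \<open>A simplex in slack coordinates is a block of nonnegative coordinates with fixed sum.
  Letting that sum depend affinely on the later blocks deforms the product without changing
  its face lattice, as long as the sum stays positive.\<close>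

locale deformed_product =
  fixes ns :: "nat list" and \<beta> :: "nat \<Rightarrow> real" and \<gamma> :: "nat \<Rightarrow> nat \<Rightarrow> real"
  assumes cap_pos: "\<And>i z. i < length ns \<Longrightarrow> solves_from ns \<beta> \<gamma> (Suc i) z \<Longrightarrow> 0 < cap ns \<beta> \<gamma> i z"
begin

definition Q :: "vspace set" where "Q = {z. solves_from ns \<beta> \<gamma> 0 z}"

definition face :: "nat set \<Rightarrow> vspace set" where "face A = {z \<in> Q. supp z \<subseteq> A}"

lemma Q_nonneg: "z \<in> Q \<Longrightarrow> 0 \<le> crd z a"
  by (simp add: Q_def solves_from_def)

lemma Q_supp: "z \<in> Q \<Longrightarrow> supp z \<subseteq> {..<ncoords ns}"
  by (simp add: Q_def solves_from_def)

lemma Q_sum: "z \<in> Q \<Longrightarrow> i < length ns \<Longrightarrow> (\<Sum>a\<in>block ns i. crd z a) = cap ns \<beta> \<gamma> i z"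
  by (simp add: Q_def solves_from_def)

lemma Q_cap_pos: "z \<in> Q \<Longrightarrow> i < length ns \<Longrightarrow> 0 < cap ns \<beta> \<gamma> i z"
  by (rule cap_pos) (auto simp: Q_def solves_from_def)

text \<open>The parameter \<open>u\<close> may leave [0,1]: all conditions except nonnegativity are
  affine. This is what permits walking beyond a point.\<close>

lemma Q_affine:
  assumes "x \<in> Q" "y \<in> Q" "\<And>a. 0 \<le> crd ((1 - u) *\<^sub>R x + u *\<^sub>R y) a"
  shows "(1 - u) *\<^sub>R x + u *\<^sub>R y \<in> Q"
proof -
  let ?z = "(1 - u) *\<^sub>R x + u *\<^sub>R y"
  have c: "cap ns \<beta> \<gamma> i ?z = (1 - u) * cap ns \<beta> \<gamma> i x + u * cap ns \<beta> \<gamma> i y" for i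
    by (simp add: cap_def lookup_add sum.distrib sum_distrib_left distrib_left mult.left_commute)
       (simp add: algebra_simps)
  have s: "(\<Sum>a\<in>block ns i. crd ?z a) = (1 - u) * (\<Sum>a\<in>block ns i. crd x a) + u * (\<Sum>a\<in>block ns i. crd y a)" for i
    by (simp add: lookup_add sum.distrib sum_distrib_left)
  have "crd ?z a = 0" if "a \<notin> {..<ncoords ns}" for a
    using Q_supp[OF assms(1)] Q_supp[OF assms(2)] that
    by (simp add: lookup_add in_keys_iff subset_iff) (metis add_0 mult_zero_right)
  then have "supp ?z \<subseteq> {..<ncoords ns}" by (metis in_keys_iff subsetI)
  then show ?thesis
    using assms(3) c s Q_sum[OF assms(1)] Q_sum[OF assms(2)] by (simp add: Q_def solves_from_def)
qed

lemma Q_segment: "x \<in> Q \<Longrightarrow> y \<in> Q \<Longrightarrow> 0 \<le> u \<Longrightarrow> u \<le> 1 \<Longrightarrow> (1 - u) *\<^sub>R x + u *\<^sub>R y \<in> Q"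
  by (rule Q_affine) (auto simp: lookup_add Q_nonneg)

lemma convex_Q: "convex Q"
  unfolding convex_alt using Q_segment by blast

text \<open>From the last block backwards: agreement on later blocks gives equal capacities, hence
  equal block sums, and nonnegative differences with sum 0 vanish. Consequently every nonzero
  direction decreases some coordinate.\<close>

lemma Q_antichain:
  assumes x: "x \<in> Q" and y: "y \<in> Q" and le: "\<And>a. crd x a \<le> crd y a"
  shows "x = y"
proof -
  have "\<forall>a\<in>{block_off ns i..<ncoords ns}. crd x a = crd y a" if "i \<le> length ns" for i
    using that
  proof (induction i rule: inc_induct)
    case (step i)
    have "cap ns \<beta> \<gamma> i x = cap ns \<beta> \<gamma> i y" unfolding cap_def
      using step.IH by (intro arg_cong2[where f="(+)"] sum.cong) auto
    then have "(\<Sum>a\<in>block ns i. crd x a) = (\<Sum>a\<in>block ns i. crd y a)"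
      using Q_sum[OF x] Q_sum[OF y] step.hyps by simp
    then have "(\<Sum>a\<in>block ns i. crd y a - crd x a) = 0" by (simp add: sum_subtractf)
    then have "\<forall>a\<in>block ns i. crd y a - crd x a = 0"
      using le by (subst (asm) sum_nonneg_eq_0_iff) auto
    then show ?case using step.IH by (force simp: block_def)
  qed auto
  from this[of 0] have "crd x a = crd y a" for a
    using Q_supp[OF x] Q_supp[OF y]
    by (cases "a < ncoords ns") (auto simp: in_keys_iff subset_iff, metis)
  then show ?thesis by (simp add: poly_mapping_eqI)
qed

text \<open>Walking from y through x until the first coordinate vanishes.\<close>

lemma Q_extend:
  assumes x: "x \<in> Q" and y: "y \<in> Q" and "x \<noteq> y" and sub: "supp y \<subseteq> supp x"
  obtains z where "z \<in> Q" "supp z \<subset> supp x" "x \<in> open_segment z y"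
proof -
  let ?D = "{a. crd x a < crd y a}"
  have D: "?D \<subseteq> supp x"
  proof
    fix a assume "a \<in> ?D"
    then have "a \<in> supp y" using Q_nonneg[OF x, of a] by (auto simp: in_keys_iff)
    then show "a \<in> supp x" using sub by blast
  qed
  then have finD: "finite ?D" by (rule finite_subset) simp
  have "\<not> (\<forall>a. crd y a \<le> crd x a)"
    using Q_antichain[OF y x] \<open>x \<noteq> y\<close> by blast
  then have neD: "?D \<noteq> {}" by (auto simp: not_le)
  define q where "q a = crd x a / (crd y a - crd x a)" for a
  define \<eta> where "\<eta> = Min (q ` ?D)"
  have xpos: "0 < crd x a" if "a \<in> ?D" for a
    using D that Q_nonneg[OF x, of a] by (auto simp: in_keys_iff less_le subset_iff)
  have "\<eta> \<in> q ` ?D" unfolding \<eta>_def using finD neD by (intro Min_in) auto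
  then obtain b where b: "b \<in> ?D" "\<eta> = q b" by auto
  have \<eta>: "0 < \<eta>" using b xpos[of b] by (simp add: q_def)
  have \<eta>_le: "\<eta> \<le> q a" if "a \<in> ?D" for a
    unfolding \<eta>_def using finD that by (intro Min_le) auto
  define z where "z = (1 - (-\<eta>)) *\<^sub>R x + (-\<eta>) *\<^sub>R y"
  have cz: "crd z a = crd x a + \<eta> * (crd x a - crd y a)" for a
    by (simp add: z_def lookup_add lookup_minus algebra_simps)
  have zn: "0 \<le> crd z a" for a
  proof (cases "a \<in> ?D")
    case True
    then have "\<eta> * (crd y a - crd x a) \<le> crd x a"
      using \<eta>_le[OF True] by (simp add: q_def pos_le_divide_eq)
    then show ?thesis by (simp add: cz algebra_simps)
  next
    case False
    then show ?thesis using \<eta> Q_nonneg[OF x, of a] by (simp add: cz)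
  qed
  have zQ: "z \<in> Q" unfolding z_def by (rule Q_affine[OF x y]) (use zn in \<open>simp add: z_def\<close>)
  have "crd z b = 0" using b by (simp add: cz q_def field_simps)
  moreover have "b \<in> supp x" using b D by blast
  moreover have "supp z \<subseteq> supp x"
    using sub by (auto simp: in_keys_iff cz subset_iff)
  ultimately have ss: "supp z \<subset> supp x" by (auto simp: in_keys_iff)
  have "x \<in> open_segment z y"
    unfolding in_segment
  proof (intro conjI exI)
    show "z \<noteq> y"
    proof
      assume "z = y"
      then have "(1 + \<eta>) *\<^sub>R x = (1 + \<eta>) *\<^sub>R y" unfolding z_def by (simp add: algebra_simps)
      then show False using \<open>x \<noteq> y\<close> \<eta> by simp
    qed
    show "0 < \<eta> / (1 + \<eta>)" "\<eta> / (1 + \<eta>) < 1" using \<eta> by auto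
    have e: "1 - \<eta> / (1 + \<eta>) = 1 / (1 + \<eta>)" using \<eta> by (simp add: field_simps)
    have "crd x a = crd ((1 - \<eta> / (1 + \<eta>)) *\<^sub>R z + (\<eta> / (1 + \<eta>)) *\<^sub>R y) a" for a
    proof -
      have "crd ((1 - \<eta> / (1 + \<eta>)) *\<^sub>R z + (\<eta> / (1 + \<eta>)) *\<^sub>R y) a
          = (crd z a + \<eta> * crd y a) / (1 + \<eta>)"
        unfolding e by (simp add: lookup_add add_divide_distrib)
      also have "crd z a + \<eta> * crd y a = (1 + \<eta>) * crd x a" by (simp add: cz algebra_simps)
      finally show ?thesis using \<eta> by simp
    qed
    then show "x = (1 - \<eta> / (1 + \<eta>)) *\<^sub>R z + (\<eta> / (1 + \<eta>)) *\<^sub>R y"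
      by (rule poly_mapping_eqI)
  qed
  then show ?thesis using that zQ ss by blast
qed

text \<open>\<open>?V\<close> consists of the vertices, the points determined by their support, so
  it is finite. Any other point lies strictly between two points of smaller support, and induction
  on the support applies.\<close>

lemma polytope_Q: "polytope Q"
proof -
  let ?V = "{v \<in> Q. \<forall>y\<in>Q. supp y \<subseteq> supp v \<longrightarrow> y = v}"
  have "finite (supp ` ?V)"
    by (rule finite_subset[of _ "Pow {..<ncoords ns}"]) (use Q_supp in auto)
  moreover have "inj_on supp ?V" by (auto simp: inj_on_def)
  ultimately have finV: "finite ?V" by (rule finite_imageD)
  have "x \<in> convex hull ?V" if "x \<in> Q" for x
    using that
  proof (induction "card (supp x)" arbitrary: x rule: less_induct)
    case (less x)
    show ?case
    proof (cases "x \<in> ?V")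
      case True
      then show ?thesis by (rule hull_inc)
    next
      case False
      then obtain y0 where y0: "y0 \<in> Q" "supp y0 \<subseteq> supp x" "y0 \<noteq> x" using less.prems by auto
      \<comment> \<open>If \<open>y0\<close> has the same support as \<open>x\<close>, the walk from
        \<open>x\<close> through \<open>y0\<close> ends at a point of strictly smaller
        support.\<close>
      obtain y where y: "y \<in> Q" "supp y \<subset> supp x"
      proof (cases "supp y0 = supp x")
        case True
        then show ?thesis by (metis Q_extend[OF y0(1) less.prems y0(3)] order_refl that)
      next
        case False
        then show ?thesis using y0 that by blast
      qed
      then have "y \<noteq> x" by auto
      then obtain z where z: "z \<in> Q" "supp z \<subset> supp x" "x \<in> open_segment z y"
        using Q_extend[OF less.prems y(1)] y(2) by blast
      have "z \<in> convex hull ?V" "y \<in> convex hull ?V"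
        using less.hyps z y by (auto simp: psubset_card_mono)
      then have "open_segment z y \<subseteq> convex hull ?V"
        by (meson convex_convex_hull convex_contains_open_segment)
      then show ?thesis using z(3) by blast
    qed
  qed
  moreover have "convex hull ?V \<subseteq> Q" by (rule hull_minimal) (auto simp: convex_Q)
  ultimately have "Q = convex hull ?V" by blast
  then show ?thesis using finV unfolding polytope_def by blast
qed

lemma supp_transversal: "z \<in> Q \<Longrightarrow> supp z \<in> transversals ns"
proof -
  assume z: "z \<in> Q"
  have "supp z \<inter> block ns i \<noteq> {}" if "i < length ns" for i
  proof
    assume "supp z \<inter> block ns i = {}"
    then have "(\<Sum>a\<in>block ns i. crd z a) = 0" by (intro sum.neutral) (auto simp: in_keys_iff)
    then show False using Q_sum[OF z that] Q_cap_pos[OF z that] by simp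
  qed
  then show ?thesis using Q_supp[OF z] by (simp add: transversals_def)
qed

text \<open>The system is solved from the last block backwards, each capacity being spread evenly
  over the elements of \<open>A\<close> in its block; positive capacities make the support exactly
  \<open>A\<close>.\<close>

lemma ex_supp:
  assumes A: "A \<in> transversals ns"
  obtains z where "z \<in> Q" "supp z = A"
proof -
  have "\<exists>z. solves_from ns \<beta> \<gamma> i z \<and> supp z = A \<inter> {block_off ns i..<ncoords ns}" if "i \<le> length ns" for i
    using that
  proof (induction i rule: inc_induct)
    case base
    show ?case by (intro exI[of _ 0]) (auto simp: solves_from_def)
  next
    case (step i)
    then obtain z where z: "solves_from ns \<beta> \<gamma> (Suc i) z"
      and sz: "supp z = A \<inter> {block_off ns (Suc i)..<ncoords ns}" by blast
    have i: "i < length ns" using step.hyps by simp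
    let ?B = "A \<inter> block ns i"
    have B: "finite ?B" "?B \<noteq> {}" using A i by (auto simp: transversals_def)
    define c where "c = cap ns \<beta> \<gamma> i z / card ?B"
    have c: "0 < c" using cap_pos[OF i z] B by (simp add: c_def card_gt_0_iff)
    define z' where "z' = z + (\<Sum>a\<in>?B. Poly_Mapping.single a c)"
    have cz: "crd z' a = crd z a + (if a \<in> ?B then c else 0)" for a
      using B(1) by (simp add: z'_def lookup_add lookup_sum lookup_single when_def)
    have z0: "crd z a = 0" if "a < block_off ns (Suc i)" for a
      using sz that by (metis Int_iff atLeastLessThan_iff in_keys_iff leD)
    have zn: "0 \<le> crd z a" for a using z by (simp add: solves_from_def)
    have up: "crd z' a = crd z a" if "block_off ns (Suc i) \<le> a" for a
      using that by (auto simp: cz block_def)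
    have caps: "cap ns \<beta> \<gamma> j z' = cap ns \<beta> \<gamma> j z" if "i \<le> j" for j
      unfolding cap_def using block_off_mono[of "Suc i" "Suc j" ns] that
      by (intro arg_cong2[where f="(+)"] sum.cong) (auto simp: up)
    have "(\<Sum>a\<in>block ns j. crd z' a) = cap ns \<beta> \<gamma> j z'" if j: "i \<le> j" "j < length ns" for j
    proof (cases "j = i")
      case True
      have "(\<Sum>a\<in>block ns i. crd z' a) = (\<Sum>a\<in>block ns i. if a \<in> ?B then c else 0)"
        by (rule sum.cong) (auto simp: cz z0 block_def)
      also have "\<dots> = (\<Sum>a\<in>?B. c)"
        by (rule sum.mono_neutral_cong_right) auto
      also have "\<dots> = cap ns \<beta> \<gamma> i z" using B by (simp add: c_def)
      finally show ?thesis using True caps[of i] by simp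
    next
      case False
      then have "Suc i \<le> j" using j by simp
      then have "(\<Sum>a\<in>block ns j. crd z' a) = (\<Sum>a\<in>block ns j. crd z a)"
        using block_off_mono[of "Suc i" j ns] by (intro sum.cong) (auto simp: up block_def)
      then show ?thesis using z \<open>Suc i \<le> j\<close> j caps[of j] by (simp add: solves_from_def)
    qed
    moreover have supp: "supp z' = A \<inter> {block_off ns i..<ncoords ns}"
    proof -
      have "a \<in> supp z' \<longleftrightarrow> a \<in> supp z \<or> a \<in> ?B" for a
        using c zn[of a] by (auto simp: in_keys_iff cz add_nonneg_eq_0_iff)
      moreover have "block_off ns i \<le> block_off ns (Suc i)" by (rule block_off_mono) simp
      moreover have "block_off ns (Suc i) \<le> ncoords ns" using i by (intro block_off_mono) simp
      ultimately show ?thesis using sz by (auto simp: block_def)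
    qed
    moreover have "\<forall>a. 0 \<le> crd z' a" using zn c by (simp add: cz)
    ultimately have "solves_from ns \<beta> \<gamma> i z'" by (auto simp: solves_from_def)
    then show ?case using supp by blast
  qed
  from this[of 0] obtain z where "z \<in> Q" "supp z = A \<inter> {0..<ncoords ns}"
    by (auto simp: Q_def)
  moreover have "A \<inter> {0..<ncoords ns} = A" using A by (auto simp: transversals_def)
  ultimately show ?thesis using that by simp
qed

lemma face_subset_iff:
  assumes "A \<in> transversals ns" "B \<in> transversals ns"
  shows "face A \<subseteq> face B \<longleftrightarrow> A \<subseteq> B"
proof
  assume "face A \<subseteq> face B"
  moreover obtain z where "z \<in> Q" "supp z = A" using ex_supp[OF assms(1)] .
  ultimately show "A \<subseteq> B" by (auto simp: face_def)
qed (auto simp: face_def)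

lemma face_nonempty: "A \<in> transversals ns \<Longrightarrow> face A \<noteq> {}"
  using ex_supp[of A] by (auto simp: face_def)

lemma face_of_face: "face A face_of Q"
  unfolding face_of_def
proof (intro conjI ballI impI)
  have eq: "face A = Q \<inter> (\<Inter>a\<in>-A. {z. crd z a = 0})" by (auto simp: face_def in_keys_iff)
  have "convex {z. crd z a = 0}" for a
    by (auto simp: convex_def lookup_add)
  then show "convex (face A)" unfolding eq by (intro convex_Int convex_Q convex_INT) auto
  fix x y z assume xy: "x \<in> Q" "y \<in> Q" "z \<in> face A" "z \<in> open_segment x y"
  obtain u where u: "0 < u" "u < 1" "z = (1 - u) *\<^sub>R x + u *\<^sub>R y"
    using xy(4) by (auto simp: in_segment)
  have "crd x a = 0 \<and> crd y a = 0" if "a \<notin> A" for a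
  proof -
    have "(1 - u) * crd x a + u * crd y a = 0"
      using xy(3) that u(3) by (auto simp: face_def in_keys_iff lookup_add subset_iff)
    moreover have "0 \<le> (1 - u) * crd x a" "0 \<le> u * crd y a"
      using u xy Q_nonneg by auto
    ultimately have "(1 - u) * crd x a = 0 \<and> u * crd y a = 0" by linarith
    then show ?thesis using u by simp
  qed
  then show "x \<in> face A" "y \<in> face A" using xy by (auto simp: face_def in_keys_iff)
qed (auto simp: face_def)

text \<open>A point \<open>w\<close> of \<open>F\<close> with largest support plays the part of a
  relative interior point. Midpoints with \<open>w\<close> show that no support in \<open>F\<close>
  exceeds that of \<open>w\<close>. Conversely, the walk from a point \<open>z\<close> of
  \<open>Q\<close> with support inside that of \<open>w\<close> passes through \<open>w\<close>, so
  the face property puts \<open>z\<close> into \<open>F\<close>.\<close>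

lemma face_ofE:
  assumes F: "F face_of Q" "F \<noteq> {}"
  obtains A where "A \<in> transversals ns" "F = face A"
proof -
  have FQ: "F \<subseteq> Q" using F(1) by (rule face_of_imp_subset)
  have bnd: "card (supp z) \<le> ncoords ns" if "z \<in> F" for z
    using card_mono[OF _ Q_supp, of z] that FQ by auto
  obtain w where w: "w \<in> F" "\<And>z. z \<in> F \<Longrightarrow> card (supp z) \<le> card (supp w)"
    using ex_has_greatest_nat[of "\<lambda>z. z \<in> F" _ "\<lambda>z. card (supp z)" "Suc (ncoords ns)"] F(2) bnd
    unfolding less_Suc_eq_le by (metis all_not_in_conv)
  have "supp z \<subseteq> supp w" if z: "z \<in> F" for z
  proof -
    define m where "m = (1 - 1/2) *\<^sub>R z + (1/2::real) *\<^sub>R w"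
    have m: "m \<in> F" unfolding m_def
      using face_of_imp_convex[OF F(1), unfolded convex_alt, rule_format, OF z w(1), of "1/2"] by simp
    have cm: "crd m a = (crd z a + crd w a) / 2" for a by (simp add: m_def lookup_add)
    have "crd m a = 0 \<longleftrightarrow> crd z a = 0 \<and> crd w a = 0" for a
    proof -
      have "0 \<le> crd z a" "0 \<le> crd w a" using subsetD[OF FQ z] subsetD[OF FQ w(1)] by (auto intro: Q_nonneg)
      then show ?thesis unfolding cm by (simp add: add_nonneg_eq_0_iff)
    qed
    then have "supp m = supp z \<union> supp w" by (simp add: set_eq_iff in_keys_iff)
    then have "card (supp z \<union> supp w) \<le> card (supp w)" using w(2)[OF m] by simp
    then have "supp w = supp z \<union> supp w"
      by (intro card_seteq) auto
    then show ?thesis by blast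
  qed
  moreover have "z \<in> F" if z: "z \<in> Q" "supp z \<subseteq> supp w" for z
  proof (cases "w = z")
    case False
    then obtain x where "x \<in> Q" "w \<in> open_segment x z"
      by (metis Q_extend[OF subsetD[OF FQ w(1)] z(1)] z(2))
    then show ?thesis using F(1) w(1) z unfolding face_of_def by blast
  qed (use w in simp)
  ultimately have "F = face (supp w)" using FQ by (auto simp: face_def)
  then show ?thesis using that supp_transversal w(1) FQ by blast
qed

lemma faces_Q: "{F. F face_of Q} = insert {} (face ` transversals ns)"
  using face_of_face face_ofE empty_face_of by blast

end

section \<open>Projections preserving a skeleton\<close>

context deformed_product
begin

lemma transversal_base:
  assumes A: "A \<in> transversals ns"
  obtains b where "\<And>i. i < length ns \<Longrightarrow> b i \<in> A \<inter> block ns i" "inj_on b {..<length ns}"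
    "finite A" "length ns \<le> card A" "card (A - b ` {..<length ns}) = card A - length ns"
proof -
  define b where "b i = (SOME a. a \<in> A \<inter> block ns i)" for i
  have b: "b i \<in> A \<inter> block ns i" if "i < length ns" for i
  proof -
    have "\<exists>a. a \<in> A \<inter> block ns i" using A that unfolding transversals_def by blast
    then show ?thesis unfolding b_def by (rule someI_ex)
  qed
  have inj: "inj_on b {..<length ns}"
    by (rule inj_onI) (metis Int_iff b block_unique lessThan_iff)
  have fin: "finite A" using A finite_subset unfolding transversals_def by blast
  have sub: "b ` {..<length ns} \<subseteq> A" using b by blast
  have "card (b ` {..<length ns}) = length ns" using inj by (simp add: card_image)
  then show ?thesis
    using that[OF b inj fin] card_mono[OF fin sub] card_Diff_subset[of "b ` {..<length ns}" A] sub by simp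
qed

text \<open>In each block the coordinate \<open>b i\<close> is recovered from the homogeneous block
  equation, again backwards, so the other elements of \<open>A\<close> separate the directions of
  the face.\<close>

lemma face_diff_span:
  assumes A: "A \<in> transversals ns"
  obtains W where "finite W" "card W \<le> card A - length ns" "{x - y |x y. x \<in> face A \<and> y \<in> face A} \<subseteq> span W"
proof -
  obtain b where b: "\<And>i. i < length ns \<Longrightarrow> b i \<in> A \<inter> block ns i" "inj_on b {..<length ns}"
    and fin: "finite A" and card: "card (A - b ` {..<length ns}) = card A - length ns"
    by (rule transversal_base[OF A]) (rule that; assumption)
  define L where "L i d = (\<Sum>a\<in>{block_off ns (Suc i)..<ncoords ns}. \<gamma> i a * crd d a)" for i d
  define U where "U = {d. (\<forall>a. a \<notin> A \<longrightarrow> crd d a = 0) \<and> (\<forall>i<length ns. (\<Sum>a\<in>block ns i. crd d a) = L i d)}"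
  have Ladd: "L i (x + y) = L i x + L i y" for i x y
    by (simp add: L_def lookup_add sum.distrib distrib_left)
  have Lscale: "L i (c *\<^sub>R x) = c * L i x" for i c x
    by (simp add: L_def sum_distrib_left mult.left_commute)
  have subU: "subspace U"
    by (auto simp: subspace_def U_def Ladd Lscale lookup_add sum.distrib simp flip: sum_distrib_left)
       (simp add: L_def)
  have "d = 0" if d: "d \<in> U" "\<And>a. a \<in> A - b ` {..<length ns} \<Longrightarrow> crd d a = 0" for d
  proof -
    have "\<forall>a\<in>{block_off ns i..<ncoords ns}. crd d a = 0" if "i \<le> length ns" for i
      using that
    proof (induction i rule: inc_induct)
      case (step i)
      have i: "i < length ns" using step.hyps by simp
      have off: "crd d a = 0" if "a \<in> block ns i" "a \<noteq> b i" for a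
      proof (cases "a \<in> A")
        case True
        have "a \<notin> b ` {..<length ns}"
        proof
          assume "a \<in> b ` {..<length ns}"
          then obtain j where "j < length ns" "a = b j" by auto
          then show False using b(1)[of j] that block_unique by blast
        qed
        then show ?thesis using d(2) True by blast
      next
        case False
        then show ?thesis using d(1) by (simp add: U_def)
      qed
      have "L i d = 0" unfolding L_def using step.IH by (intro sum.neutral) auto
      then have "0 = (\<Sum>a\<in>block ns i. crd d a)" using d(1) i by (simp add: U_def)
      also have "\<dots> = crd d (b i) + (\<Sum>a\<in>block ns i - {b i}. crd d a)"
        using b(1)[OF i] by (intro sum.remove) auto
      also have "(\<Sum>a\<in>block ns i - {b i}. crd d a) = 0" using off by (intro sum.neutral) auto
      finally have "crd d (b i) = 0" by simp
      then have "\<forall>a\<in>block ns i. crd d a = 0" using off by metis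
      then show ?case using step.IH by (auto simp: block_def)
    qed auto
    from this[of 0] have "crd d a = 0" for a
      using d(1) A by (cases "a < ncoords ns") (auto simp: U_def transversals_def)
    then show ?thesis by (simp add: poly_mapping_eqI)
  qed
  then obtain W where W: "finite W" "card W \<le> card (A - b ` {..<length ns})" "U \<subseteq> span W"
    using finite_spanning_of_separating[of "A - b ` {..<length ns}" "\<lambda>a z. crd z a" U] fin subU linear_crd
    by auto
  have "x - y \<in> U" if xy: "x \<in> face A" "y \<in> face A" for x y
  proof -
    have "x \<in> Q" "y \<in> Q" and z: "\<forall>a. a \<notin> A \<longrightarrow> crd x a = 0 \<and> crd y a = 0"
      using xy by (auto simp: face_def in_keys_iff)
    then have "(\<Sum>a\<in>block ns i. crd (x - y) a) = L i (x - y)" if "i < length ns" for i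
      using Q_sum[of x i] Q_sum[of y i] that
      by (simp add: lookup_minus sum_subtractf cap_def L_def right_diff_distrib)
    then show ?thesis using z by (simp add: U_def lookup_minus)
  qed
  then have "{x - y |x y. x \<in> face A \<and> y \<in> face A} \<subseteq> span W" using W(3) by blast
  then show ?thesis using that[of W] W(1,2) card by simp
qed

lemma image_face_diff_span:
  fixes f :: "vspace \<Rightarrow> vspace"
  assumes A: "A \<in> transversals ns" and f: "linear f"
  obtains W where "finite W" "card W \<le> card A - length ns"
    "{x - y |x y. x \<in> f ` face A \<and> y \<in> f ` face A} \<subseteq> span W"
proof -
  obtain W where W: "finite W" "card W \<le> card A - length ns" "{x - y |x y. x \<in> face A \<and> y \<in> face A} \<subseteq> span W"
    by (rule face_diff_span[OF A]) (rule that; assumption)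
  have "{x - y |x y. x \<in> f ` face A \<and> y \<in> f ` face A} \<subseteq> f ` {x - y |x y. x \<in> face A \<and> y \<in> face A}"
    by (auto simp: image_iff) (metis linear_diff[OF f])
  also have "\<dots> \<subseteq> span (f ` W)" using W(3) by (auto simp: linear_span_image[OF f])
  finally show ?thesis using that[of "f ` W"] W card_image_le[OF W(1), of f] by simp
qed

text \<open>The functional lives on the image side. Hence \<open>face A\<close> is the full preimage
  of its image, which yields both the face property of the image and the injectivity of the
  correspondence.\<close>

definition exposes :: "(vspace \<Rightarrow> vspace) \<Rightarrow> nat \<Rightarrow> bool" where
  "exposes f n \<longleftrightarrow> (\<forall>A\<in>transversals ns. card A \<le> n \<longrightarrow>
     (\<exists>g c. linear g \<and> (\<forall>z\<in>Q. c \<le> g (f z) \<and> (g (f z) = (c::real) \<longleftrightarrow> supp z \<subseteq> A))))"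

lemma exposesE:
  assumes "exposes f n" "A \<in> transversals ns" "card A \<le> n"
  obtains g c where "linear g" "\<And>z. z \<in> Q \<Longrightarrow> c \<le> g (f z)"
    "\<And>z. z \<in> Q \<Longrightarrow> g (f z) = (c::real) \<longleftrightarrow> z \<in> face A"
  using assms unfolding exposes_def face_def by force

lemma image_face_of_image:
  assumes f: "linear f" and e: "exposes f n" "A \<in> transversals ns" "card A \<le> n"
  shows "f ` face A face_of f ` Q"
proof -
  obtain g c where g: "linear g" and ge: "\<And>z. z \<in> Q \<Longrightarrow> c \<le> g (f z)"
    and eq: "\<And>z. z \<in> Q \<Longrightarrow> g (f z) = (c::real) \<longleftrightarrow> z \<in> face A"
    by (rule exposesE[OF e]) (rule that; assumption)
  have sub: "face A \<subseteq> Q" by (auto simp: face_def)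
  show ?thesis
    unfolding face_of_def
  proof (intro conjI ballI impI)
    show "f ` face A \<subseteq> f ` Q" using sub by blast
    show "convex (f ` face A)"
      using face_of_imp_convex[OF face_of_face] by (rule convex_linear_image[OF f])
    fix a b y assume ab: "a \<in> f ` Q" "b \<in> f ` Q" and y: "y \<in> f ` face A" "y \<in> open_segment a b"
    obtain p q where p: "p \<in> Q" "a = f p" and q: "q \<in> Q" "b = f q" using ab by auto
    obtain u where u: "0 < u" "u < 1" "y = (1 - u) *\<^sub>R a + u *\<^sub>R b" using y(2) by (auto simp: in_segment)
    have "g y = c" using y(1) eq sub by auto
    then have "(1 - u) * g a + u * g b = c" using u(3) by (simp add: linear_add[OF g] linear_scale[OF g])
    then have "(1 - u) * (g a - c) + u * (g b - c) = 0" by (simp add: algebra_simps)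
    moreover have "0 \<le> (1 - u) * (g a - c)" "0 \<le> u * (g b - c)" using u ge p q by auto
    ultimately have "(1 - u) * (g a - c) = 0 \<and> u * (g b - c) = 0" by linarith
    then have "g a = c" "g b = c" using u by auto
    then show "a \<in> f ` face A" "b \<in> f ` face A" using eq p q by auto
  qed
qed

lemma image_face_mem:
  assumes e: "exposes f n" "A \<in> transversals ns" "card A \<le> n" and z: "z \<in> Q" "f z \<in> f ` face A"
  shows "z \<in> face A"
proof -
  obtain g c where "linear g" and eq: "\<And>z. z \<in> Q \<Longrightarrow> g (f z) = (c::real) \<longleftrightarrow> z \<in> face A"
    by (rule exposesE[OF e]) (rule that; assumption)
  obtain x where x: "x \<in> face A" "f z = f x" using z(2) by blast
  then have "x \<in> Q" by (simp add: face_def)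
  then show ?thesis using eq[OF z(1)] eq[of x] x by simp
qed

lemma image_face_subset_iff:
  assumes e: "exposes f n" "B \<in> transversals ns" "card B \<le> n" and A: "A \<in> transversals ns"
  shows "f ` face A \<subseteq> f ` face B \<longleftrightarrow> A \<subseteq> B"
proof
  assume sub: "f ` face A \<subseteq> f ` face B"
  obtain z where z: "z \<in> Q" "supp z = A" using ex_supp[OF A] .
  then have "f z \<in> f ` face B" using sub by (auto simp: face_def)
  then have "z \<in> face B" by (rule image_face_mem[OF e z(1)])
  then show "A \<subseteq> B" using z by (simp add: face_def)
qed (auto simp: face_def)

lemma pdim_image_face_less:
  assumes f: "linear f" and e: "exposes f n" "B \<in> transversals ns" "card B \<le> n"
    and A: "A \<in> transversals ns" "B \<subset> A"
  shows "pdim (f ` face B) < pdim (f ` face A)"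
proof -
  obtain g c where g: "linear g" and eq: "\<And>z. z \<in> Q \<Longrightarrow> g (f z) = (c::real) \<longleftrightarrow> z \<in> face B"
    by (rule exposesE[OF e]) (rule that; assumption)
  obtain W where W: "finite W" "{x - y |x y. x \<in> f ` face A \<and> y \<in> f ` face A} \<subseteq> span W"
    by (rule image_face_diff_span[OF A(1) f]) (rule that; assumption)
  obtain z where z: "z \<in> Q" "supp z = A" using ex_supp[OF A(1)] .
  show ?thesis
  proof (rule pdim_less[OF _ _ g _ _ _ W(2,1)])
    show "f ` face B \<subseteq> f ` face A" using A(2) by (auto simp: face_def)
    show "f ` face B \<noteq> {}" using face_nonempty e by simp
    show "g x = c" if "x \<in> f ` face B" for x using that eq by (auto simp: face_def)
    show "f z \<in> f ` face A" using z by (simp add: face_def)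
    show "g (f z) \<noteq> c" using z A(2) eq[OF z(1)] by (auto simp: face_def)
  qed
qed

text \<open>For the lower bound, elements of \<open>A\<close> outside a choice of one per block are
  removed one by one; every removal lowers the dimension strictly because the smaller face is
  exposed.\<close>

lemma pdim_image_face:
  assumes f: "linear f" and e: "exposes f n" "A \<in> transversals ns" "card A \<le> n"
  shows "pdim (f ` face A) = int (card A - length ns)"
proof (rule antisym)
  obtain W where "finite W" "card W \<le> card A - length ns"
      "{x - y |x y. x \<in> f ` face A \<and> y \<in> f ` face A} \<subseteq> span W"
    by (rule image_face_diff_span[OF e(2) f]) (rule that; assumption)
  then show "pdim (f ` face A) \<le> int (card A - length ns)"
    using pdim_le_card[of "f ` face A" W] by linarith
  show "int (card A - length ns) \<le> pdim (f ` face A)"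
    using e(2,3)
  proof (induction "card A" arbitrary: A)
    case 0
    then show ?case using face_nonempty[of A] by (simp add: pdim_def)
  next
    case (Suc m)
    obtain b where b: "\<And>i. i < length ns \<Longrightarrow> b i \<in> A \<inter> block ns i" and fin: "finite A"
      and card: "card (A - b ` {..<length ns}) = card A - length ns"
      by (rule transversal_base[OF Suc.prems(1)]) (rule that; assumption)
    show ?case
    proof (cases "card A \<le> length ns")
      case True
      then show ?thesis using face_nonempty[OF Suc.prems(1)] by (simp add: pdim_def)
    next
      case False
      then have "A - b ` {..<length ns} \<noteq> {}" using card by (metis card.empty diff_is_0_eq)
      then obtain a where a: "a \<in> A" "a \<notin> b ` {..<length ns}" by blast
      have "b i \<in> (A - {a}) \<inter> block ns i" if "i < length ns" for i using b[OF that] a that by auto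
      then have t: "A - {a} \<in> transversals ns" using Suc.prems(1) unfolding transversals_def by blast
      have cA: "m = card (A - {a})" using Suc.hyps(2) a by simp
      have "int (card (A - {a}) - length ns) \<le> pdim (f ` face (A - {a}))"
        using Suc.hyps(1)[OF cA t] Suc.prems(2) Suc.hyps(2) cA by simp
      moreover have "pdim (f ` face (A - {a})) < pdim (f ` face A)"
        using a Suc.prems(2) Suc.hyps(2) cA
        by (intro pdim_image_face_less[OF f e(1) t _ Suc.prems(1)]) auto
      ultimately show ?thesis using Suc.hyps(2) cA False by linarith
    qed
  qed
qed

text \<open>A face of the image pulls back to some \<open>face A\<close>. If \<open>A\<close> were
  too large, it would properly contain a transversal \<open>?B\<close> with exactly
  \<open>k + length ns\<close> elements; the image of \<open>face ?B\<close> already has dimension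
  \<open>k\<close>, and that of \<open>face A\<close> is strictly larger in dimension.\<close>

lemma skeleton_image:
  assumes f: "linear f" and e: "exposes f (k + length ns)"
  shows "skeleton k (f ` Q) = insert {} ((\<lambda>A. f ` face A) ` {A \<in> transversals ns. card A \<le> k + length ns})"
proof (intro equalityI subsetI)
  fix G assume G: "G \<in> skeleton k (f ` Q)"
  show "G \<in> insert {} ((\<lambda>A. f ` face A) ` {A \<in> transversals ns. card A \<le> k + length ns})"
  proof (cases "G = {}")
    case False
    have Gf: "G face_of f ` Q" and Gd: "pdim G \<le> int k" using G by (auto simp: skeleton_def)
    let ?F = "{z \<in> Q. f z \<in> G}"
    have GF: "G = f ` ?F" using face_of_imp_subset[OF Gf] by blast
    have "?F face_of Q"
      unfolding face_of_def
    proof (intro conjI ballI impI)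
      show "convex ?F"
        unfolding convex_alt
        using Q_segment face_of_imp_convex[OF Gf, unfolded convex_alt]
        by (simp add: linear_add[OF f] linear_scale[OF f])
      fix a b x assume ab: "a \<in> Q" "b \<in> Q" and x: "x \<in> ?F" "x \<in> open_segment a b"
      obtain u where u: "0 < u" "u < 1" "x = (1 - u) *\<^sub>R a + u *\<^sub>R b" using x(2) by (auto simp: in_segment)
      have fx: "f x = (1 - u) *\<^sub>R f a + u *\<^sub>R f b" by (simp add: u(3) linear_add[OF f] linear_scale[OF f])
      have "f a \<in> G \<and> f b \<in> G"
      proof (cases "f a = f b")
        case True
        then have "f x = f a" using fx by (simp flip: scaleR_left_distrib)
        then show ?thesis using x True by simp
      next
        case False
        then have "f x \<in> open_segment (f a) (f b)" unfolding in_segment using u fx by blast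
        then show ?thesis using Gf ab x(1) unfolding face_of_def by blast
      qed
      then show "a \<in> ?F" "b \<in> ?F" using ab by auto
    qed auto
    then obtain A where A: "A \<in> transversals ns" "?F = face A"
      using face_ofE False GF by (metis (no_types, lifting) image_empty)
    have "card A \<le> k + length ns"
    proof (rule ccontr)
      assume "\<not> card A \<le> k + length ns"
      then have big: "k + length ns < card A" by simp
      obtain b where b: "\<And>i. i < length ns \<Longrightarrow> b i \<in> A \<inter> block ns i" "inj_on b {..<length ns}" and fin: "finite A"
        and card: "card (A - b ` {..<length ns}) = card A - length ns"
        by (rule transversal_base[OF A(1)]) (rule that; assumption)
      obtain C where C: "C \<subseteq> A - b ` {..<length ns}" "card C = k"
      proof (rule obtain_subset_with_card_n[of k "A - b ` {..<length ns}"])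
        show "k \<le> card (A - b ` {..<length ns})" using big card by simp
      qed (rule that)
      let ?B = "C \<union> b ` {..<length ns}"
      have sub: "?B \<subseteq> A" using C b(1) by auto
      have t: "?B \<in> transversals ns" using A(1) sub b(1) unfolding transversals_def by blast
      have "card ?B = card C + card (b ` {..<length ns})"
        using C fin by (intro card_Un_disjoint) (auto intro: finite_subset)
      then have cB: "card ?B = k + length ns" using C b(2) by (simp add: card_image)
      then have "?B \<subset> A" using sub big by auto
      then have "pdim (f ` face ?B) < pdim (f ` face A)"
        using cB by (intro pdim_image_face_less[OF f e t _ A(1)]) auto
      moreover have "pdim (f ` face ?B) = int k" using pdim_image_face[OF f e t] cB by simp
      ultimately show False using Gd GF A(2) by simp
    qed
    then show ?thesis using A GF by auto
  qed simp
next
  fix G assume "G \<in> insert {} ((\<lambda>A. f ` face A) ` {A \<in> transversals ns. card A \<le> k + length ns})"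
  then consider "G = {}" | A where "A \<in> transversals ns" "card A \<le> k + length ns" "G = f ` face A" by auto
  then show "G \<in> skeleton k (f ` Q)"
  proof cases
    case 1
    then show ?thesis by (auto simp: skeleton_def pdim_def)
  next
    case 2
    then show ?thesis
      using image_face_of_image[OF f e] pdim_image_face[OF f e] by (simp add: skeleton_def)
  qed
qed

end

text \<open>Indices with equal \<open>F\<close> have equal \<open>G\<close>, so the choice made by
  \<open>SOME\<close> is harmless. The empty face has no index and is matched separately.\<close>

lemma poset_iso_of_index:
  assumes 1: "\<And>i j. i \<in> I \<Longrightarrow> j \<in> I \<Longrightarrow> F i \<subseteq> F j \<longleftrightarrow> G i \<subseteq> G j"
    and 2: "\<And>i. i \<in> I \<Longrightarrow> F i \<noteq> {}" "\<And>i. i \<in> I \<Longrightarrow> G i \<noteq> {}"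
  shows "poset_iso (insert {} (F ` I)) (insert {} (G ` I))"
proof -
  define h where "h X = (if X = {} then {} else G (SOME i. i \<in> I \<and> F i = X))" for X
  have hF: "h (F i) = G i" if "i \<in> I" for i
  proof -
    let ?j = "SOME j. j \<in> I \<and> F j = F i"
    have j: "?j \<in> I \<and> F ?j = F i" by (rule someI[of _ i]) (use that in simp)
    then have "G ?j \<subseteq> G i" "G i \<subseteq> G ?j" using 1[of ?j i] 1[of i ?j] that by auto
    then show ?thesis using 2(1)[OF that] by (simp add: h_def)
  qed
  have h0: "h {} = {}" by (simp add: h_def)
  have "h ` insert {} (F ` I) = insert {} (G ` I)" using hF h0 by (auto simp: image_iff)
  moreover have ord: "X \<subseteq> Y \<longleftrightarrow> h X \<subseteq> h Y" if XY: "X \<in> insert {} (F ` I)" "Y \<in> insert {} (F ` I)" for X Y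
  proof (cases "X = {} \<or> Y = {}")
    case True
    then show ?thesis using XY 2 by (auto simp: hF h0)
  next
    case False
    then obtain i j where "i \<in> I" "X = F i" "j \<in> I" "Y = F j" using XY by blast
    then show ?thesis using 1 by (simp add: hF)
  qed
  moreover have "inj_on h (insert {} (F ` I))"
  proof (rule inj_onI)
    fix X Y assume XY: "X \<in> insert {} (F ` I)" "Y \<in> insert {} (F ` I)" "h X = h Y"
    have "h X \<subseteq> h Y" "h Y \<subseteq> h X" by (simp_all only: XY(3) order_refl)
    then show "X = Y"
      by (intro subset_antisym iffD2[OF ord[OF XY(1,2)]] iffD2[OF ord[OF XY(2,1)]])
  qed
  ultimately show ?thesis unfolding poset_iso_def bij_betw_def by (intro exI[of _ h]) auto
qed

section \<open>Bounding \<open>delta_pr\<close> by a number of functionals\<close>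

interpretation simplices: deformed_product ns "\<lambda>_. 1" "\<lambda>_ _. 0" for ns
  by unfold_locales (simp add: cap_def)

lemma prod_simplex_eq: "prod_simplex ns = simplices.Q ns"
  by (auto simp: prod_simplex_def simplices.Q_def solves_from_def cap_def block_def block_off_def
      atLeast0LessThan)

definition ev :: "nat list \<Rightarrow> (nat \<Rightarrow> real) \<Rightarrow> vspace \<Rightarrow> real" where
  "ev ns h z = (\<Sum>a<ncoords ns. h a * crd z a)"

lemma linear_ev: "linear (ev ns h)"
  by (rule linearI) (simp_all add: ev_def lookup_add distrib_left sum.distrib sum_distrib_left mult.left_commute)

context deformed_product
begin

lemma ev_nonneg_zero_iff:
  assumes h: "\<And>a. a < ncoords ns \<Longrightarrow> 0 \<le> h a \<and> (h a = 0 \<longleftrightarrow> a \<in> A)" and z: "z \<in> Q"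
  shows "0 \<le> ev ns h z" "ev ns h z = 0 \<longleftrightarrow> supp z \<subseteq> A"
proof -
  have nn: "0 \<le> h a * crd z a" if "a < ncoords ns" for a using h[OF that] Q_nonneg[OF z] by simp
  then show "0 \<le> ev ns h z" unfolding ev_def by (intro sum_nonneg) auto
  have "ev ns h z = 0 \<longleftrightarrow> (\<forall>a<ncoords ns. h a * crd z a = 0)"
    unfolding ev_def using nn by (subst sum_nonneg_eq_0_iff) auto
  also have "\<dots> \<longleftrightarrow> (\<forall>a<ncoords ns. a \<in> A \<or> a \<notin> supp z)"
    using h by (auto simp: in_keys_iff)
  also have "\<dots> \<longleftrightarrow> supp z \<subseteq> A" using Q_supp[OF z] by auto
  finally show "ev ns h z = 0 \<longleftrightarrow> supp z \<subseteq> A" .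
qed

text \<open>Equality is demanded only on \<open>Q\<close> and up to a constant, so functionals that
  are constant on \<open>Q\<close> come for free. Every saving of dimensions enters here.\<close>

definition affine_rep :: "(nat \<Rightarrow> real) set \<Rightarrow> (nat \<Rightarrow> real) \<Rightarrow> bool" where
  "affine_rep \<F> h \<longleftrightarrow> (\<exists>c0 c. \<forall>z\<in>Q. ev ns h z = c0 + (\<Sum>\<phi>\<in>\<F>. c \<phi> * ev ns \<phi> z))"

theorem delta_pr_le_card:
  assumes fin: "finite \<F>"
    and ex: "\<And>A. A \<in> transversals ns \<Longrightarrow> card A \<le> k + length ns \<Longrightarrow>
      \<exists>h. (\<forall>a<ncoords ns. 0 \<le> h a \<and> (h a = 0 \<longleftrightarrow> a \<in> A)) \<and> affine_rep \<F> h"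
  shows "delta_pr k ns \<le> card \<F>"
proof -
  obtain e where e: "bij_betw e \<F> {..<card \<F>}"
    using ex_bij_betw_finite_nat[OF fin] by (auto simp: atLeast0LessThan)
  have inj: "inj_on e \<F>" and rng: "e ` \<F> = {..<card \<F>}" using e by (auto simp: bij_betw_def)
  define f where "f z = (\<Sum>\<phi>\<in>\<F>. Poly_Mapping.single (e \<phi>) (ev ns \<phi> z))" for z
  have cf: "crd (f z) i = (\<Sum>\<phi>\<in>\<F>. if e \<phi> = i then ev ns \<phi> z else 0)" for z i
    by (simp add: f_def lookup_sum lookup_single when_def)
  have cfe: "crd (f z) (e \<phi>) = ev ns \<phi> z" if "\<phi> \<in> \<F>" for z \<phi>
  proof -
    have "crd (f z) (e \<phi>) = (\<Sum>\<psi>\<in>\<F>. if \<psi> = \<phi> then ev ns \<psi> z else 0)"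
      unfolding cf using inj that by (intro sum.cong) (auto simp: inj_on_eq_iff)
    then show ?thesis using fin that by simp
  qed
  have linf: "linear f"
  proof (rule linearI; rule poly_mapping_eqI)
    fix x y i show "crd (f (x + y)) i = crd (f x + f y) i"
      by (simp add: cf lookup_add linear_add[OF linear_ev] flip: sum.distrib) (rule sum.cong; auto simp: linear_add[OF linear_ev] linear_scale[OF linear_ev])
  next
    fix c x i show "crd (f (c *\<^sub>R x)) i = crd (c *\<^sub>R f x) i"
      by (simp add: cf linear_scale[OF linear_ev] sum_distrib_left) (rule sum.cong; auto simp: linear_add[OF linear_ev] linear_scale[OF linear_ev])
  qed
  have expo: "exposes f (k + length ns)"
    unfolding exposes_def
  proof (intro ballI impI)
    fix A assume A: "A \<in> transversals ns" "card A \<le> k + length ns"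
    obtain h c0 c where h: "\<forall>a<ncoords ns. 0 \<le> h a \<and> (h a = 0 \<longleftrightarrow> a \<in> A)"
      and c: "\<forall>z\<in>Q. ev ns h z = c0 + (\<Sum>\<phi>\<in>\<F>. c \<phi> * ev ns \<phi> z)"
      using ex[OF A] unfolding affine_rep_def by auto
    define g where "g y = (\<Sum>\<phi>\<in>\<F>. c \<phi> * crd y (e \<phi>))" for y
    have "linear g"
      by (rule linearI) (simp_all add: g_def lookup_add distrib_left sum.distrib sum_distrib_left mult.left_commute)
    moreover have "g (f z) = ev ns h z - c0" if "z \<in> Q" for z
      using c that by (simp add: g_def cfe)
    moreover have "0 \<le> ev ns h z" "ev ns h z = 0 \<longleftrightarrow> supp z \<subseteq> A" if "z \<in> Q" for z
      using ev_nonneg_zero_iff[OF _ that, of h A] h by auto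
    ultimately have "\<forall>z\<in>Q. - c0 \<le> g (f z) \<and> (g (f z) = - c0 \<longleftrightarrow> supp z \<subseteq> A)"
      by simp
    then show "\<exists>g c. linear g \<and> (\<forall>z\<in>Q. c \<le> g (f z) \<and> (g (f z) = (c::real) \<longleftrightarrow> supp z \<subseteq> A))"
      using \<open>linear g\<close> by blast
  qed
  \<comment> \<open>The identity exposes all faces of the standard product, so
    \<open>skeleton_image\<close> indexes both skeleta by the same transversals.\<close>
  have "simplices.exposes ns (\<lambda>z. z) (k + length ns)"
    unfolding simplices.exposes_def
  proof (intro ballI impI)
    fix A assume "A \<in> transversals ns"
    let ?h = "\<lambda>a. if a \<in> A then 0 else 1"
    show "\<exists>g c. linear g \<and> (\<forall>z\<in>simplices.Q ns. c \<le> g z \<and> (g z = (c::real) \<longleftrightarrow> supp z \<subseteq> A))"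
      using simplices.ev_nonneg_zero_iff[of ns ?h A] linear_ev
      by (intro exI[of _ "ev ns ?h"] exI[of _ 0]) auto
  qed
  then have skel: "skeleton k (prod_simplex ns)
      = insert {} (simplices.face ns ` {A \<in> transversals ns. card A \<le> k + length ns})"
    using simplices.skeleton_image[of "\<lambda>z. z" ns k] by (simp add: prod_simplex_eq linear_ident)
  have "poset_iso (skeleton k (f ` Q)) (skeleton k (prod_simplex ns))"
    unfolding skel skeleton_image[OF linf expo]
  proof (rule poset_iso_of_index)
    fix A B assume "A \<in> {A \<in> transversals ns. card A \<le> k + length ns}"
      "B \<in> {A \<in> transversals ns. card A \<le> k + length ns}"
    then show "f ` face A \<subseteq> f ` face B \<longleftrightarrow> simplices.face ns A \<subseteq> simplices.face ns B"
      by (simp add: image_face_subset_iff[OF expo] simplices.face_subset_iff)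
  qed (auto simp: face_nonempty simplices.face_nonempty)
  moreover have polP: "polytope (f ` Q)"
    using polytope_Q convex_hull_linear_image[OF linf] unfolding polytope_def by (metis finite_imageI)
  ultimately have "PSN k ns (f ` Q)" by (simp add: PSN_def)
  moreover have "comb_equiv Q (prod_simplex ns)"
    unfolding comb_equiv_def prod_simplex_eq faces_Q simplices.faces_Q
    by (rule poset_iso_of_index)
       (simp_all add: face_subset_iff simplices.face_subset_iff face_nonempty simplices.face_nonempty)
  ultimately have PP: "PPSN k ns (f ` Q)"
    unfolding PPSN_def using polytope_Q linf by blast
  let ?U = "{y. supp y \<subseteq> {..<card \<F>}}"
  have "\<exists>W. finite W \<and> card W \<le> card {..<card \<F>} \<and> ?U \<subseteq> span W"
  proof (rule finite_spanning_of_separating[where \<phi> = "\<lambda>i y. crd y i"])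
    show "subspace ?U"
      by (auto simp: subspace_def subset_iff in_keys_iff lookup_add) (metis add_0)
    show "d = 0" if "d \<in> ?U" "\<And>i. i \<in> {..<card \<F>} \<Longrightarrow> crd d i = 0" for d
      using that by (intro poly_mapping_eqI) (auto simp: in_keys_iff subset_iff)
  qed (auto simp: linear_crd)
  then obtain W where W: "finite W" "card W \<le> card \<F>" "?U \<subseteq> span W" by auto
  have "crd (f z) i = 0" if "i \<notin> {..<card \<F>}" for z i
    unfolding cf using that rng by (intro sum.neutral) auto
  then have "{x - y |x y. x \<in> f ` Q \<and> y \<in> f ` Q} \<subseteq> ?U"
    by (auto simp: in_keys_iff lookup_minus not_less[symmetric]) (metis diff_self lessThan_iff)
  then have dimP: "pdim (f ` Q) \<le> int (card \<F>)"
    using pdim_le_card[of "f ` Q" W] W by fastforce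
  have "Q \<noteq> {}"
  proof -
    have "{..<ncoords ns} \<in> transversals ns"
    proof -
      have "block_off ns i \<in> {..<ncoords ns} \<inter> block ns i" if "i < length ns" for i
        using block_below[OF that, of "block_off ns i"] that by (simp add: block_def block_off_Suc)
      then show ?thesis unfolding transversals_def by blast
    qed
    then show ?thesis using ex_supp by blast
  qed
  then have "pdim (f ` Q) = int (nat (pdim (f ` Q)))" by (simp add: pdim_def)
  then have "delta_pr k ns \<le> nat (pdim (f ` Q))"
    unfolding delta_pr_def using PP by (intro Least_le) blast
  then show ?thesis using dimP by linarith
qed

end

lemma ev_add: "ev ns (\<lambda>a. h a + h' a) z = ev ns h z + ev ns h' z"
  by (simp add: ev_def distrib_right sum.distrib)

lemma ev_scale: "ev ns (\<lambda>a. c * h a) z = c * ev ns h z"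
  by (simp add: ev_def sum_distrib_left mult.assoc)

context deformed_product
begin

lemma affine_rep_base: "finite \<F> \<Longrightarrow> \<phi> \<in> \<F> \<Longrightarrow> affine_rep \<F> \<phi>"
  unfolding affine_rep_def
  by (intro exI[of _ 0] exI[of _ "\<lambda>\<psi>. if \<psi> = \<phi> then 1 else 0"])
     (simp add: if_distrib[of "\<lambda>c. c * _"] cong: if_cong)

lemma affine_rep_const: "(\<And>z. z \<in> Q \<Longrightarrow> ev ns h z = c) \<Longrightarrow> affine_rep \<F> h"
  unfolding affine_rep_def by (intro exI[of _ c] exI[of _ "\<lambda>_. 0"]) simp

lemma affine_rep_add:
  assumes "affine_rep \<F> h" "affine_rep \<F> h'"
  shows "affine_rep \<F> (\<lambda>a. h a + h' a)"
proof -
  obtain c0 c d0 d where "\<forall>z\<in>Q. ev ns h z = c0 + (\<Sum>\<phi>\<in>\<F>. c \<phi> * ev ns \<phi> z)"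
    "\<forall>z\<in>Q. ev ns h' z = d0 + (\<Sum>\<phi>\<in>\<F>. d \<phi> * ev ns \<phi> z)"
    using assms unfolding affine_rep_def by blast
  then show ?thesis unfolding affine_rep_def ev_add
    by (intro exI[of _ "c0 + d0"] exI[of _ "\<lambda>\<phi>. c \<phi> + d \<phi>"]) (simp add: distrib_right sum.distrib)
qed

lemma affine_rep_scale:
  assumes "affine_rep \<F> h"
  shows "affine_rep \<F> (\<lambda>a. c * h a)"
proof -
  obtain d0 d where "\<forall>z\<in>Q. ev ns h z = d0 + (\<Sum>\<phi>\<in>\<F>. d \<phi> * ev ns \<phi> z)"
    using assms unfolding affine_rep_def by blast
  then show ?thesis unfolding affine_rep_def ev_scale
    by (intro exI[of _ "c * d0"] exI[of _ "\<lambda>\<phi>. c * d \<phi>"])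
       (simp add: distrib_left sum_distrib_left mult.assoc)
qed

lemma affine_rep_sum:
  assumes "\<And>i. i \<in> I \<Longrightarrow> affine_rep \<F> (h i)"
  shows "affine_rep \<F> (\<lambda>a. \<Sum>i\<in>I. h i a)"
  using assms
proof (induction I rule: infinite_finite_induct)
  case (insert i I)
  then show ?case using affine_rep_add[of \<F> "h i" "\<lambda>a. \<Sum>i\<in>I. h i a"] by simp
qed (auto intro: affine_rep_const[where c = 0] simp: ev_def)

end

section \<open>Moments at integer points and the zeros demanded by a face\<close>

lemma sum_blocks:
  assumes "i \<le> j"
  shows "(\<Sum>a\<in>{block_off ns i..<block_off ns j}. f a) = (\<Sum>l\<in>{i..<j}. \<Sum>a\<in>block ns l. f a)"
  using assms
proof (induction j rule: dec_induct)
  case (step j)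
  have "(\<Sum>a\<in>{block_off ns i..<block_off ns (Suc j)}. f a)
      = (\<Sum>a\<in>{block_off ns i..<block_off ns j}. f a) + (\<Sum>a\<in>block ns j. f a)"
    unfolding block_def using step.hyps
    by (intro sum.atLeastLessThan_concat[symmetric] block_off_mono) auto
  then show ?case using step by simp
qed simp

text \<open>This is the polynomial written Q(t) in the overview; in the code \<open>Q\<close> is the
  polytope.\<close>

definition square_root_poly :: "nat set \<Rightarrow> real poly" where
  "square_root_poly B = (\<Prod>b\<in>B. [:- real b, 1:]\<^sup>2)"

lemma square_root_poly:
  assumes "finite B"
  shows "0 \<le> poly (square_root_poly B) x" "poly (square_root_poly B) (real n) = 0 \<longleftrightarrow> n \<in> B"
    "degree (square_root_poly B) \<le> 2 * card B"
proof -
  have "degree (square_root_poly B) \<le> (\<Sum>b\<in>B. degree ([:- real b, 1:]\<^sup>2))"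
    unfolding square_root_poly_def using degree_prod_sum_le[OF assms] by (simp add: o_def)
  also have "\<dots> \<le> (\<Sum>b\<in>B. 2)" by (intro sum_mono) (simp add: degree_power_eq)
  finally show "degree (square_root_poly B) \<le> 2 * card B" by simp
qed (auto simp: square_root_poly_def poly_prod assms intro: prod_nonneg)

text \<open>Both coordinates of a segment are attached to one and the same point of the moment curve,
  so that a vertex of a segment costs nothing; the coordinates of the other simplices get
  distinct points.\<close>

locale segmented =
  fixes ns :: "nat list" and s :: nat
  assumes s_le: "s \<le> length ns" and seg: "\<And>i. i < s \<Longrightarrow> ns ! i = 1"
begin

definition pt :: "nat \<Rightarrow> nat" where "pt a = (if a < 2 * s then a div 2 else a - s)"

definition mom :: "(nat \<Rightarrow> real) \<Rightarrow> real poly \<Rightarrow> nat \<Rightarrow> real" where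
  "mom wt q a = wt a * poly q (real (pt a))"

definition seg_diff :: "nat \<Rightarrow> nat \<Rightarrow> real" where
  "seg_diff j a = (if a = 2 * j then 1 else if a = 2 * j + 1 then -1 else 0)"

definition zero_pts :: "nat set \<Rightarrow> nat set" where
  "zero_pts A = {j. j < s \<and> 2 * j \<in> A \<and> 2 * j + 1 \<in> A} \<union> pt ` (A \<inter> {2 * s..})"

text \<open>The factor \<open>1 - seg_sign A j * seg_diff j a\<close> is 0 at one endpoint of
  segment \<open>j\<close> and 2 at the other; the sign puts the zero at an endpoint in
  \<open>A\<close>. If both endpoints are in \<open>A\<close>, the factor in front of it vanishes at
  the point \<open>j\<close>.\<close>

definition seg_sign :: "nat set \<Rightarrow> nat \<Rightarrow> real" where
  "seg_sign A j = (if 2 * j \<in> A then 1 else -1)"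

lemma block_off_seg: "i \<le> s \<Longrightarrow> block_off ns i = 2 * i"
proof (induction i)
  case (Suc i)
  then show ?case using s_le seg[of i] by (simp add: block_off_Suc)
qed simp

lemma block_seg: "i < s \<Longrightarrow> block ns i = {2 * i, 2 * i + 1}"
  using block_off_seg[of i] block_off_seg[of "Suc i"] by (auto simp: block_def)

lemma pt_big: "2 * s \<le> a \<Longrightarrow> pt a = a - s" and pt_small: "a < 2 * s \<Longrightarrow> pt a = a div 2"
  by (auto simp: pt_def)

lemma pt_less_s_iff: "pt a < s \<longleftrightarrow> a < 2 * s"
  by (auto simp: pt_def)

lemma seg_hit: "A \<in> transversals ns \<Longrightarrow> j < s \<Longrightarrow> 2 * j \<in> A \<or> 2 * j + 1 \<in> A"
proof -
  assume "A \<in> transversals ns" "j < s"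
  then have "A \<inter> block ns j \<noteq> {}" using s_le by (simp add: transversals_def)
  then show ?thesis using block_seg[OF \<open>j < s\<close>] by auto
qed

lemma finite_zero_pts: "A \<in> transversals ns \<Longrightarrow> finite (zero_pts A)"
  unfolding zero_pts_def transversals_def by (auto intro: finite_subset)

lemma zero_pts_big: "2 * s \<le> a \<Longrightarrow> pt a \<in> zero_pts A \<longleftrightarrow> a \<in> A"
proof -
  assume a: "2 * s \<le> a"
  have "\<not> pt a < s" using a by (simp add: pt_big)
  moreover have "pt a \<in> pt ` (A \<inter> {2 * s..}) \<longleftrightarrow> a \<in> A"
  proof
    assume "pt a \<in> pt ` (A \<inter> {2 * s..})"
    then obtain b where b: "b \<in> A" "2 * s \<le> b" "pt a = pt b" by auto
    then have "a = b" using a by (simp add: pt_big)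
    then show "a \<in> A" using b by simp
  qed (use a in auto)
  ultimately show ?thesis by (simp add: zero_pts_def)
qed

lemma zero_pts_seg: "j < s \<Longrightarrow> j \<in> zero_pts A \<longleftrightarrow> 2 * j \<in> A \<and> 2 * j + 1 \<in> A"
  by (auto simp: zero_pts_def pt_big)

text \<open>\<open>A\<close> contains one endpoint \<open>c j\<close> of each segment, a second
  endpoint for each segment in \<open>?D\<close>, and \<open>?Z\<close>. The \<open>s\<close>
  endpoints \<open>c j\<close> cause no zeros, so the zeros number at most
  \<open>card A - s\<close>.\<close>

lemma card_zero_pts:
  assumes A: "A \<in> transversals ns" and c: "card A \<le> k + length ns"
  shows "card (zero_pts A) \<le> k + (length ns - s)"
proof -
  let ?D = "{j. j < s \<and> 2 * j \<in> A \<and> 2 * j + 1 \<in> A}" and ?Z = "A \<inter> {2 * s..}"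
  define c where "c j = (if 2 * j \<in> A then 2 * j else 2 * j + 1)" for j
  let ?X = "c ` {..<s}" and ?Y = "(\<lambda>j. 2 * j + 1) ` ?D"
  have fin: "finite A" using A finite_subset unfolding transversals_def by blast
  have cd: "c j div 2 = j" for j by (auto simp: c_def)
  have "inj_on c {..<s}" by (rule inj_onI) (metis cd)
  then have "card ?X = s" by (simp add: card_image)
  moreover have "card ?Y = card ?D" by (rule card_image) (auto simp: inj_on_def)
  moreover have "card (?X \<union> ?Y) = card ?X + card ?Y"
  proof (rule card_Un_disjoint)
    show "?X \<inter> ?Y = {}"
    proof safe
      fix i j assume h: "c i = 2 * j + 1" "2 * j \<in> A"
      then have "i = j" using cd[of i] by simp
      then show "c i \<in> {}" using h by (simp add: c_def)
    qed
  qed auto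
  moreover have "card (?X \<union> ?Y \<union> ?Z) = card (?X \<union> ?Y) + card ?Z"
  proof (rule card_Un_disjoint)
    have "c j < 2 * s" if "j < s" for j using that by (simp add: c_def)
    then show "(?X \<union> ?Y) \<inter> ?Z = {}" by fastforce
  qed (use fin in auto)
  moreover have "?X \<union> ?Y \<union> ?Z \<subseteq> A"
    using seg_hit[OF A] by (auto simp: c_def)
  then have "card (?X \<union> ?Y \<union> ?Z) \<le> card A" by (rule card_mono[OF fin])
  moreover have "card (zero_pts A) \<le> card ?D + card (pt ` ?Z)" unfolding zero_pts_def by (rule card_Un_le)
  moreover have "card (pt ` ?Z) \<le> card ?Z" by (rule card_image_le) (use fin in auto)
  ultimately show ?thesis using c s_le by linarith
qed

lemma mom_add: "mom wt (p + q) a = mom wt p a + mom wt q a"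
  by (simp add: mom_def distrib_left)

lemma mom_smult: "mom wt (smult c p) a = c * mom wt p a"
  by (simp add: mom_def)

lemma mom_sum: "mom wt (\<Sum>i\<in>I. p i) a = (\<Sum>i\<in>I. mom wt (p i) a)"
  by (simp add: mom_def poly_sum sum_distrib_left)

lemma sum_seg_diff:
  assumes "j < s" "a \<in> {2 * j, 2 * j + 1}"
  shows "(\<Sum>i<s. c i * seg_diff i a) = c j * seg_diff j a"
proof -
  have "(\<Sum>i<s. c i * seg_diff i a) = (\<Sum>i\<in>{j}. c i * seg_diff i a)"
  proof (rule sum.mono_neutral_right)
    have "seg_diff i a = 0" if "i \<noteq> j" for i
      using assms(2) that unfolding seg_diff_def
      by (cases "a = 2 * i"; cases "a = 2 * i + 1") auto
    then show "\<forall>i\<in>{..<s} - {j}. c i * seg_diff i a = 0" by simp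
  qed (use assms in auto)
  then show ?thesis by simp
qed

lemma sum_seg_diff_big: "2 * s \<le> a \<Longrightarrow> (\<Sum>i<s. c i * seg_diff i a) = 0"
  by (intro sum.neutral) (auto simp: seg_diff_def)

end

section \<open>Lagrange interpolation at integer points\<close>

lemma poly_prod_roots_dvd:
  fixes p :: "'a::idom poly"
  assumes "finite B" "\<And>b. b \<in> B \<Longrightarrow> poly p b = 0"
  shows "(\<Prod>b\<in>B. [:- b, 1:]) dvd p"
  using assms
proof (induction B arbitrary: p rule: finite_induct)
  case (insert b B)
  then obtain q where q: "p = [:- b, 1:] * q" using poly_eq_0_iff_dvd[of p b] by auto
  have "(\<Prod>b\<in>B. [:- b, 1:]) dvd q"
    using insert.prems insert.hyps(2) by (intro insert.IH) (force simp: q)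
  then have "[:- b, 1:] * (\<Prod>b\<in>B. [:- b, 1:]) dvd p" unfolding q by (rule mult_dvd_mono[OF dvd_refl])
  then show ?case using insert.hyps by (simp only: prod.insert not_False_eq_True)
qed simp

definition lagrange :: "nat set \<Rightarrow> nat \<Rightarrow> real poly" where
  "lagrange B b = smult (1 / (\<Prod>c\<in>B - {b}. real b - real c)) (\<Prod>c\<in>B - {b}. [:- real c, 1:])"

lemma poly_lagrange:
  assumes "finite B" "b \<in> B" "c \<in> B"
  shows "poly (lagrange B b) (real c) = (if c = b then 1 else 0)"
proof (cases "c = b")
  case True
  have "(\<Prod>c\<in>B - {b}. real b - real c) \<noteq> 0" using assms(1) by auto
  then show ?thesis using True by (simp add: lagrange_def poly_prod)
next
  case False
  then have "poly (\<Prod>c\<in>B - {b}. [:- real c, 1:]) (real c) = 0" using assms by (simp add: poly_prod)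
  then show ?thesis using False by (simp add: lagrange_def)
qed

lemma degree_lagrange:
  assumes "finite B" "b \<in> B"
  shows "degree (lagrange B b) < card B"
proof -
  have "degree (lagrange B b) \<le> degree (\<Prod>c\<in>B - {b}. [:- real c, 1:])"
    unfolding lagrange_def by (rule degree_smult_le)
  also have "\<dots> \<le> (\<Sum>c\<in>B - {b}. degree [:- real c, 1:])"
    using degree_prod_sum_le[of "B - {b}" "\<lambda>c. [:- real c, 1:]"] assms by (simp add: o_def)
  also have "\<dots> = card B - 1" using assms by simp
  finally show ?thesis using assms by (metis Suc_pred' card_gt_0_iff empty_iff le_imp_less_Suc)
qed

lemma poly_lagrange_sum:
  assumes "finite B" "c \<in> B"
  shows "poly (\<Sum>b\<in>B. smult (y b) (lagrange B b)) (real c) = y c"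
  using assms by (simp add: poly_sum poly_lagrange if_distrib cong: if_cong)

lemma degree_lagrange_sum:
  assumes "finite B" "card B \<le> Suc m"
  shows "degree (\<Sum>b\<in>B. smult (y b) (lagrange B b)) \<le> m"
proof (intro degree_sum_le assms(1))
  fix b assume "b \<in> B"
  then have "degree (lagrange B b) < Suc m" using degree_lagrange[OF assms(1)] assms(2) by fastforce
  then show "degree (smult (y b) (lagrange B b)) \<le> m"
    using degree_smult_le[of "y b" "lagrange B b"] by linarith
qed

section \<open>Interpolation on the small blocks\<close>

context segmented
begin

lemma seg_value:
  assumes A: "A \<in> transversals ns" and j: "j < s" and w: "0 \<le> w" "w = 0 \<longleftrightarrow> j \<in> zero_pts A"
    and a: "a \<in> {2 * j, 2 * j + 1}"
  shows "0 \<le> w * (1 - seg_sign A j * seg_diff j a)"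
    and "w * (1 - seg_sign A j * seg_diff j a) = 0 \<longleftrightarrow> a \<in> A"
  using seg_hit[OF A j] w zero_pts_seg[OF j, of A] a by (auto simp: seg_sign_def seg_diff_def)

text \<open>Distinct coordinates share a point only when they are the two ends of one segment, so
  points still tell the blocks apart.\<close>

lemma pt_mem_image_block:
  assumes "i < length ns"
  shows "pt a \<in> pt ` block ns i \<longleftrightarrow> a \<in> block ns i"
proof
  assume "pt a \<in> pt ` block ns i"
  then obtain b where b: "b \<in> block ns i" "pt a = pt b" by auto
  show "a \<in> block ns i"
  proof (cases "b < 2 * s")
    case True
    let ?j = "b div 2"
    have j: "?j < s" using True by simp
    have "b \<in> block ns ?j" unfolding block_seg[OF j] by auto
    then have i: "i = ?j" using b(1) block_unique by blast
    have "a < 2 * s" using True b(2) pt_less_s_iff[of a] pt_less_s_iff[of b] by simp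
    then have "a div 2 = ?j" using True b(2) by (simp add: pt_small)
    then show ?thesis unfolding i block_seg[OF j] by auto
  next
    case False
    then have "\<not> a < 2 * s" using b(2) pt_less_s_iff[of a] pt_less_s_iff[of b] by simp
    then have "a = b" using False b(2) by (simp add: pt_big)
    then show ?thesis using b(1) by simp
  qed
qed simp

end

locale interpolated = segmented +
  fixes t :: nat
  assumes s_le_t: "s \<le> t" and t_le: "t \<le> length ns"
begin

abbreviation bt :: nat where "bt \<equiv> block_off ns t"

definition npts :: nat where "npts = bt - s"

definition vanishing :: "real poly" where "vanishing = (\<Prod>b<npts. [:- real b, 1:])"

text \<open>On the blocks from \<open>t\<close> on, the weight turns the moment of
  \<open>vanishing\<close> into 1, while it is 0 on the small blocks. Its total is therefore the
  number of large blocks, a constant. All large points lie beyond the roots, so the weights are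
  positive.\<close>

definition wt :: "nat \<Rightarrow> real" where
  "wt a = (if a < bt then 1 else 1 / poly vanishing (real (pt a)))"

definition block_poly :: "nat \<Rightarrow> real poly" where
  "block_poly i = (\<Sum>b\<in>pt ` block ns i. lagrange {..<npts} b)"

text \<open>On the small blocks the moment of \<open>block_poly i\<close> is the indicator of block
  \<open>i\<close>. The capacity subtracts its values on the large blocks, so the complete moment is
  the constant \<open>level\<close> on the polytope.\<close>

definition \<gamma> :: "nat \<Rightarrow> nat \<Rightarrow> real" where
  "\<gamma> i a = (if i < t \<and> bt \<le> a then - mom wt (block_poly i) a else 0)"

text \<open>Coordinates in the blocks from \<open>t\<close> on lie in [0,1], so the variable part of
  a capacity is at most \<open>level - 1\<close> in absolute value and the capacity stays
  positive.\<close>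

definition level :: real where "level = 1 + (\<Sum>i<t. \<Sum>a<ncoords ns. \<bar>\<gamma> i a\<bar>)"

definition \<beta> :: "nat \<Rightarrow> real" where "\<beta> i = (if i < t then level else 1)"

lemma bt_ge: "2 * s \<le> bt"
  using block_off_mono[OF s_le_t, of ns] block_off_seg[of s] by simp

lemma bt_le: "bt \<le> ncoords ns"
  by (rule block_off_mono[OF t_le])

lemma pt_less_npts_iff: "pt a < npts \<longleftrightarrow> a < bt"
  using bt_ge by (auto simp: pt_def npts_def)

lemma block_less_bt: "i < t \<Longrightarrow> block ns i \<subseteq> {..<bt}"
  using block_off_mono[of "Suc i" t ns] by (auto simp: block_def)

lemma vanishing_pos: "bt \<le> a \<Longrightarrow> 0 < poly vanishing (real (pt a))"
  using pt_less_npts_iff[of a] by (auto simp: vanishing_def poly_prod intro!: prod_pos)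

lemma wt_pos: "0 < wt a"
  using vanishing_pos[of a] by (simp add: wt_def)

lemma mom_block_poly:
  assumes "i < t" "a < bt"
  shows "mom wt (block_poly i) a = (if a \<in> block ns i then 1 else 0)"
proof -
  have sub: "pt ` block ns i \<subseteq> {..<npts}" using block_less_bt[OF assms(1)] pt_less_npts_iff by auto
  have "poly (block_poly i) (real (pt a)) = (\<Sum>b\<in>pt ` block ns i. if pt a = b then 1 else 0)"
    unfolding block_poly_def poly_sum
    using sub assms(2) pt_less_npts_iff by (intro sum.cong) (auto simp: poly_lagrange)
  also have "\<dots> = (if pt a \<in> pt ` block ns i then 1 else 0)" by simp
  finally show ?thesis using assms t_le by (simp add: mom_def wt_def pt_mem_image_block)
qed

sublocale deformed_product ns \<beta> \<gamma>
proof
  fix i z assume i: "i < length ns" and z: "solves_from ns \<beta> \<gamma> (Suc i) z"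
  show "0 < cap ns \<beta> \<gamma> i z"
  proof (cases "i < t")
    case False
    then show ?thesis by (simp add: cap_def \<beta>_def \<gamma>_def)
  next
    case True
    let ?I = "{block_off ns (Suc i)..<ncoords ns}"
    have nn: "0 \<le> crd z a" for a using z by (simp add: solves_from_def)
    have le1: "crd z a \<le> 1" if a: "bt \<le> a" "a < ncoords ns" for a
    proof -
      obtain j where j: "j < length ns" "a \<in> block ns j" using ex_block[OF a(2)] by blast
      then have "t \<le> j" using block_less_bt[of j] a(1) by (metis lessThan_iff not_less subsetD)
      have "crd z a \<le> (\<Sum>b\<in>block ns j. crd z b)" using j nn by (intro member_le_sum) auto
      also have "\<dots> = cap ns \<beta> \<gamma> j z" using z True j \<open>t \<le> j\<close> by (simp add: solves_from_def)
      also have "\<dots> = 1" using \<open>t \<le> j\<close> by (simp add: cap_def \<beta>_def \<gamma>_def)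
      finally show ?thesis .
    qed
    have "\<bar>\<gamma> i a * crd z a\<bar> \<le> \<bar>\<gamma> i a\<bar>" if "a \<in> ?I" for a
      using le1[of a] nn[of a] that by (cases "bt \<le> a") (auto simp: abs_mult \<gamma>_def mult_left_le)
    then have "\<bar>\<Sum>a\<in>?I. \<gamma> i a * crd z a\<bar> \<le> (\<Sum>a\<in>?I. \<bar>\<gamma> i a\<bar>)"
      by (intro order.trans[OF sum_abs] sum_mono)
    also have "\<dots> \<le> (\<Sum>a<ncoords ns. \<bar>\<gamma> i a\<bar>)" by (rule sum_mono2) auto
    also have "\<dots> \<le> (\<Sum>i<t. \<Sum>a<ncoords ns. \<bar>\<gamma> i a\<bar>)"
      using True by (intro member_le_sum) (auto intro: sum_nonneg)
    also have "\<dots> < level" by (simp add: level_def)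
    finally show ?thesis using True by (simp add: cap_def \<beta>_def)
  qed
qed

lemma ev_split: "ev ns h z = (\<Sum>a\<in>{0..<bt}. h a * crd z a) + (\<Sum>a\<in>{bt..<ncoords ns}. h a * crd z a)"
  unfolding ev_def using sum.atLeastLessThan_concat[of 0 bt "ncoords ns" "\<lambda>a. h a * crd z a"] bt_le
  by (simp add: lessThan_atLeast0)

lemma ev_block_poly:
  assumes "z \<in> Q" "i < t"
  shows "ev ns (mom wt (block_poly i)) z = level"
proof -
  have "(\<Sum>a\<in>{0..<bt}. mom wt (block_poly i) a * crd z a) = (\<Sum>a\<in>{0..<bt}. if a \<in> block ns i then crd z a else 0)"
    using assms(2) by (intro sum.cong) (auto simp: mom_block_poly)
  also have "\<dots> = (\<Sum>a\<in>block ns i. crd z a)"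
    using block_less_bt[OF assms(2)] by (intro sum.mono_neutral_cong_right) auto
  also have "\<dots> = level + (\<Sum>a\<in>{block_off ns (Suc i)..<ncoords ns}. \<gamma> i a * crd z a)"
    using Q_sum[OF assms(1), of i] assms(2) t_le by (simp add: cap_def \<beta>_def)
  also have "(\<Sum>a\<in>{block_off ns (Suc i)..<ncoords ns}. \<gamma> i a * crd z a) = (\<Sum>a\<in>{bt..<ncoords ns}. \<gamma> i a * crd z a)"
    using block_off_mono[of "Suc i" t ns] assms(2) by (intro sum.mono_neutral_right) (auto simp: \<gamma>_def)
  also have "\<dots> = - (\<Sum>a\<in>{bt..<ncoords ns}. mom wt (block_poly i) a * crd z a)"
    unfolding sum_negf[symmetric] using assms(2) by (intro sum.cong) (auto simp: \<gamma>_def)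
  finally show ?thesis by (simp add: ev_split)
qed

lemma mom_vanishing: "mom wt (vanishing * q) a = (if a < bt then 0 else poly q (real (pt a)))"
proof (cases "a < bt")
  case True
  then have "poly vanishing (real (pt a)) = 0"
    using pt_less_npts_iff[of a] by (auto simp: vanishing_def poly_prod)
  then show ?thesis using True by (simp add: mom_def)
next
  case False
  then show ?thesis using vanishing_pos[of a] by (simp add: mom_def wt_def)
qed

lemma ev_vanishing:
  assumes "z \<in> Q"
  shows "ev ns (mom wt (vanishing * 1)) z = real (length ns - t)"
proof -
  have "ev ns (mom wt (vanishing * 1)) z = (\<Sum>a\<in>{bt..<ncoords ns}. crd z a)"
    unfolding ev_split mom_vanishing by simp
  also have "\<dots> = (\<Sum>j\<in>{t..<length ns}. cap ns \<beta> \<gamma> j z)"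
    unfolding sum_blocks[OF t_le] using Q_sum[OF assms] by (intro sum.cong) auto
  also have "\<dots> = real (length ns - t)" by (simp add: cap_def \<beta>_def \<gamma>_def)
  finally show ?thesis .
qed

text \<open>One point per small block whose Lagrange functional can be omitted: it equals the
  constant moment of \<open>block_poly i\<close> minus the other Lagrange functionals of the
  block.\<close>

definition base :: "nat \<Rightarrow> nat" where "base i = pt (block_off ns i)"

lemma base_mem: "i < t \<Longrightarrow> base i \<in> pt ` block ns i"
  using t_le by (auto simp: base_def block_def block_off_Suc)

lemma image_block_disjoint:
  "i < length ns \<Longrightarrow> j < length ns \<Longrightarrow> b \<in> pt ` block ns i \<Longrightarrow> b \<in> pt ` block ns j \<Longrightarrow> i = j"
  using pt_mem_image_block block_unique by blast

lemma card_nonbase: "t \<le> npts" "card ({..<npts} - base ` {..<t}) = npts - t"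
proof -
  have "inj_on base {..<t}"
    by (rule inj_onI) (use base_mem image_block_disjoint t_le in \<open>metis lessThan_iff order.strict_trans2\<close>)
  then have c: "card (base ` {..<t}) = t" by (simp add: card_image)
  have sub: "base ` {..<t} \<subseteq> {..<npts}"
    using base_mem block_less_bt pt_less_npts_iff by fastforce
  show "t \<le> npts" using card_mono[OF _ sub] c by simp
  show "card ({..<npts} - base ` {..<t}) = npts - t"
    using card_Diff_subset[OF _ sub] c by simp
qed

text \<open>A segment has a single point, which is its base point, so it contributes only its
  difference. The exponent \<open>l\<close> starts at 1 because the moment of
  \<open>vanishing\<close> itself is constant on \<open>Q\<close>.\<close>

definition functionals :: "nat \<Rightarrow> (nat \<Rightarrow> real) set" where
  "functionals m = seg_diff ` {..<s} \<union> (\<lambda>b. mom wt (lagrange {..<npts} b)) ` ({..<npts} - base ` {..<t})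
     \<union> (\<lambda>l. mom wt (vanishing * monom 1 l)) ` {1..m - npts}"

lemma finite_functionals: "finite (functionals m)"
  by (simp add: functionals_def)

lemma card_functionals: "card (functionals m) \<le> s + (npts - t) + (m - npts)"
proof -
  have "card (functionals m) \<le> card (seg_diff ` {..<s})
      + card ((\<lambda>b. mom wt (lagrange {..<npts} b)) ` ({..<npts} - base ` {..<t}))
      + card ((\<lambda>l. mom wt (vanishing * monom 1 l)) ` {1..m - npts})"
    unfolding functionals_def by (meson card_Un_le add_le_mono1 order_trans)
  also have "\<dots> \<le> card {..<s} + card ({..<npts} - base ` {..<t}) + card {1..m - npts}"
    by (intro add_mono card_image_le) auto
  finally show ?thesis by (simp add: card_nonbase)
qed

lemma affine_rep_lagrange:
  assumes b: "b < npts"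
  shows "affine_rep (functionals m) (mom wt (lagrange {..<npts} b))"
proof (cases "b \<in> base ` {..<t}")
  case False
  then show ?thesis using b by (intro affine_rep_base finite_functionals) (auto simp: functionals_def)
next
  case True
  then obtain i where i: "i < t" "b = base i" by auto
  let ?B = "pt ` block ns i - {b}"
  have nb: "affine_rep (functionals m) (mom wt (lagrange {..<npts} c))" if c: "c \<in> ?B" for c
  proof -
    have "c < npts" using c block_less_bt[OF i(1)] pt_less_npts_iff by auto
    moreover have "c \<noteq> base j" if "j < t" for j
      using image_block_disjoint[of i j c] base_mem[OF that] i c that t_le by auto
    ultimately show ?thesis
      by (intro affine_rep_base finite_functionals) (auto simp: functionals_def)
  qed
  have "affine_rep (functionals m) (\<lambda>a. mom wt (block_poly i) a
      + (-1) * (\<Sum>c\<in>?B. mom wt (lagrange {..<npts} c) a))"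
    by (intro affine_rep_add affine_rep_scale affine_rep_sum nb affine_rep_const[where c = level])
       (use ev_block_poly i in auto)
  moreover have "mom wt (block_poly i) a + (-1) * (\<Sum>c\<in>?B. mom wt (lagrange {..<npts} c) a)
      = mom wt (lagrange {..<npts} b) a" for a
    unfolding block_poly_def mom_sum
    using base_mem[OF i(1)] i(2) by (subst sum.remove[of _ b]) auto
  ultimately show ?thesis by simp
qed

text \<open>Subtracting the interpolant at the small points leaves a multiple of
  \<open>vanishing\<close>. The bound on \<open>npts\<close> keeps the interpolant within degree
  \<open>m\<close>; in the borderline case \<open>npts = Suc m\<close> the quotient is 0.\<close>

lemma affine_rep_mom:
  assumes q: "degree q \<le> m" and m: "npts \<le> Suc m"
  shows "affine_rep (functionals m) (mom wt q)"
proof -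
  let ?L = "\<Sum>b<npts. smult (poly q (real b)) (lagrange {..<npts} b)"
  have L: "degree ?L \<le> m" using degree_lagrange_sum[of "{..<npts}" m] m by simp
  have "(\<Prod>b\<in>real ` {..<npts}. [:- b, 1:]) dvd q - ?L"
    by (rule poly_prod_roots_dvd) (auto simp: poly_lagrange_sum[of "{..<npts}"])
  moreover have "(\<Prod>b\<in>real ` {..<npts}. [:- b, 1:]) = vanishing"
    unfolding vanishing_def by (subst prod.reindex) (auto simp: inj_on_def)
  ultimately obtain h where h: "q - ?L = vanishing * h" by (auto elim: dvdE)
  have deg_v: "degree vanishing = npts" and v0: "vanishing \<noteq> 0"
    by (auto simp: vanishing_def degree_prod_eq_sum_degree)
  have coeff: "coeff h l = 0" if "m < npts + l" for l
  proof (rule ccontr)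
    assume "coeff h l \<noteq> 0"
    then have "h \<noteq> 0" "l \<le> degree h" by (auto intro: le_degree)
    then have "npts + l \<le> degree (vanishing * h)" using v0 deg_v by (simp add: degree_mult_eq)
    also have "\<dots> \<le> m" unfolding h[symmetric] by (rule degree_diff_le[OF q L])
    finally show False using that by simp
  qed
  have h_exp: "poly h x = (\<Sum>l\<in>{..<Suc m - npts}. coeff h l * x ^ l)" for x
  proof -
    have "poly h x = (\<Sum>l\<le>degree h. coeff h l * x ^ l)" by (rule poly_altdef)
    also have "\<dots> = (\<Sum>l\<in>{..<Suc m - npts}. coeff h l * x ^ l)"
      by (rule sum.mono_neutral_cong) (use coeff in \<open>auto simp: coeff_eq_0\<close>)
    finally show ?thesis .
  qed
  have "mom wt q a = (\<Sum>b<npts. poly q (real b) * mom wt (lagrange {..<npts} b) a)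
      + (\<Sum>l<Suc m - npts. coeff h l * mom wt (vanishing * monom 1 l) a)" for a
  proof -
    have "q = ?L + vanishing * h" using h by (simp add: algebra_simps)
    then have "mom wt q a = mom wt ?L a + mom wt (vanishing * h) a" using mom_add by metis
    then show ?thesis by (simp add: mom_sum mom_smult mom_vanishing h_exp poly_monom)
  qed
  then have eq: "mom wt q = (\<lambda>a. (\<Sum>b<npts. poly q (real b) * mom wt (lagrange {..<npts} b) a)
      + (\<Sum>l<Suc m - npts. coeff h l * mom wt (vanishing * monom 1 l) a))" by blast
  have mono: "affine_rep (functionals m) (mom wt (vanishing * monom 1 l))" if "l < Suc m - npts" for l
  proof (cases "l = 0")
    case True
    then show ?thesis using ev_vanishing by (intro affine_rep_const) (auto simp: monom_0)
  next
    case False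
    then show ?thesis using that
      by (intro affine_rep_base finite_functionals) (auto simp: functionals_def)
  qed
  show ?thesis unfolding eq
    by (intro affine_rep_add affine_rep_sum affine_rep_scale affine_rep_lagrange mono) auto
qed

theorem delta_pr_le:
  assumes m: "npts \<le> Suc (2 * (k + (length ns - s)))"
  shows "delta_pr k ns \<le> s + (npts - t) + (2 * (k + (length ns - s)) - npts)"
proof -
  let ?m = "2 * (k + (length ns - s))"
  have "delta_pr k ns \<le> card (functionals ?m)"
  proof (rule delta_pr_le_card[OF finite_functionals])
    fix A assume A: "A \<in> transversals ns" "card A \<le> k + length ns"
    let ?q = "square_root_poly (zero_pts A)"
    have fin: "finite (zero_pts A)" by (rule finite_zero_pts[OF A(1)])
    have deg: "degree ?q \<le> ?m" by (rule order.trans[OF square_root_poly(3)[OF fin] mult_le_mono2[OF card_zero_pts[OF A]]])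
    \<comment> \<open>On segment \<open>j\<close>, where the weight is 1, this is the value of
      \<open>?q\<close> at \<open>j\<close> times \<open>1 - seg_sign A j * seg_diff j a\<close>; on
      the other blocks the differences vanish and the weighted polynomial remains.\<close>
    define h where "h a = mom wt ?q a + (\<Sum>j<s. - (seg_sign A j * poly ?q (real j)) * seg_diff j a)" for a
    have "affine_rep (functionals ?m) h"
      unfolding h_def
      by (intro affine_rep_add affine_rep_mom[OF deg m] affine_rep_sum affine_rep_scale
          affine_rep_base finite_functionals) (auto simp: functionals_def)
    moreover have "0 \<le> h a \<and> (h a = 0 \<longleftrightarrow> a \<in> A)" if "a < ncoords ns" for a
    proof (cases "a < 2 * s")
      case True
      let ?j = "a div 2"
      have j: "?j < s" "a \<in> {2 * ?j, 2 * ?j + 1}" using True by auto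
      have "wt a = 1" using True bt_ge by (simp add: wt_def)
      then have "h a = poly ?q (real ?j) * (1 - seg_sign A ?j * seg_diff ?j a)"
        unfolding h_def sum_seg_diff[OF j] using True by (simp add: mom_def pt_small algebra_simps)
      then show ?thesis
        using seg_value[OF A(1) j(1) square_root_poly(1)[OF fin] square_root_poly(2)[OF fin] j(2)]
        by (simp only: simp_thms)
    next
      case False
      then have "h a = wt a * poly ?q (real (pt a))"
        unfolding h_def by (subst sum_seg_diff_big) (auto simp: mom_def)
      then show ?thesis
        using wt_pos[of a] square_root_poly(1,2)[OF fin] zero_pts_big[of a A] False by simp
    qed
    ultimately show "\<exists>h. (\<forall>a<ncoords ns. 0 \<le> h a \<and> (h a = 0 \<longleftrightarrow> a \<in> A)) \<and> affine_rep (functionals ?m) h"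
      by blast
  qed
  then show ?thesis using card_functionals[of ?m] by linarith
qed

end

section \<open>Chains of segments\<close>

text \<open>Banach iteration from 0 in the sup norm. Finite support bounds the first step uniformly,
  after which the steps shrink geometrically and the pointwise limit has a uniform error
  bound.\<close>

lemma finite_support_contraction:
  fixes F :: "(nat \<Rightarrow> real) \<Rightarrow> nat \<Rightarrow> real"
  assumes supp: "\<And>v n. N \<le> n \<Longrightarrow> F v n = 0"
    and contr: "\<And>v w c n. (\<And>i. \<bar>v i - w i\<bar> \<le> c) \<Longrightarrow> \<bar>F v n - F w n\<bar> \<le> c / 2"
  shows "\<exists>v. F v = v"
proof -
  define v where "v k = (F ^^ k) (\<lambda>_. 0)" for k
  define D where "D = (\<Sum>n<N. \<bar>v 1 n\<bar>)"
  have vS: "v (Suc k) = F (v k)" for k by (simp add: v_def)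
  have step: "\<bar>v (Suc k) n - v k n\<bar> \<le> D * (1 / 2) ^ k" for k n
  proof (induction k arbitrary: n)
    case 0
    have "\<bar>v 1 n\<bar> \<le> D"
    proof (cases "n < N")
      case True
      then show ?thesis unfolding D_def by (intro member_le_sum) auto
    next
      case False
      then show ?thesis using supp[of n "v 0"] vS[of 0] by (simp add: D_def sum_nonneg)
    qed
    then show ?case by (simp add: v_def)
  next
    case (Suc k)
    then show ?case using contr[of "v (Suc k)" "v k" "D * (1 / 2) ^ k" n] by (simp add: vS)
  qed
  define L where "L n = suminf (\<lambda>k. v (Suc k) n - v k n)" for n
  have geo: "summable (\<lambda>k. D * (1 / 2 :: real) ^ (k + l))" for l
    by (intro summable_mult summable_ignore_initial_segment summable_geometric) simp
  have sm: "summable (\<lambda>k. v (Suc k) n - v k n)" for n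
    by (rule summable_comparison_test'[OF geo[of 0], of 0]) (use step in simp)
  have tele: "(\<Sum>k<l. v (Suc k) n - v k n) = v l n" for l n
    by (subst sum_lessThan_telescope) (simp add: v_def)
  have lim: "(\<lambda>l. v l n) \<longlonglongrightarrow> L n" for n
    using summable_LIMSEQ[OF sm[of n]] unfolding tele L_def .
  have tail: "\<bar>v l n - L n\<bar> \<le> 2 * D * (1 / 2) ^ l" for l n
  proof -
    have "L n - v l n = suminf (\<lambda>k. v (Suc (k + l)) n - v (k + l) n)"
      unfolding L_def using suminf_minus_initial_segment[OF sm[of n], of l] by (simp add: tele)
    also have "\<bar>\<dots>\<bar> \<le> suminf (\<lambda>k. D * (1 / 2) ^ (k + l))"
      using norm_suminf_le[OF _ geo[of l], where f = "\<lambda>k. v (Suc (k + l)) n - v (k + l) n"] step by simp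
    also have "\<dots> = suminf (\<lambda>k. (D * (1 / 2) ^ l) * (1 / 2) ^ k)" by (simp add: power_add mult_ac)
    also have "\<dots> = 2 * D * (1 / 2) ^ l"
      by (subst suminf_mult) (auto simp: suminf_geometric summable_geometric)
    finally show ?thesis by (simp add: abs_minus_commute)
  qed
  have "F L n = L n" for n
  proof -
    have le: "\<bar>v (Suc l) n - F L n\<bar> \<le> D * (1 / 2) ^ l" for l
      using contr[of "v l" L "2 * D * (1 / 2) ^ l" n, OF tail] by (simp add: vS)
    have "(\<lambda>l. D * (1 / 2 :: real) ^ l) \<longlonglongrightarrow> 0"
      by (intro tendsto_mult_right_zero LIMSEQ_power_zero) simp
    then have "(\<lambda>l. v (Suc l) n - F L n) \<longlonglongrightarrow> 0"
      by (rule Lim_null_comparison[rotated]) (simp add: le)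
    then have "(\<lambda>l. v (Suc l) n) \<longlonglongrightarrow> F L n" by (rule LIM_zero_cancel)
    then show ?thesis by (rule LIMSEQ_unique[OF _ LIMSEQ_Suc[OF lim]])
  qed
  then show ?thesis by blast
qed

text \<open>The squared polynomial vanishing on B survives a small perturbation of the conditions:
  a solution v is a fixed point of a contraction whose correction term interpolates, on B,
  the perturbation that has to be cancelled there.\<close>

lemma perturbed_square_root_poly:
  fixes \<tau> :: "nat \<Rightarrow> real"
  assumes B: "B \<subseteq> {..<N}" and \<tau>: "\<And>n. \<bar>\<tau> n\<bar> \<le> 1"
  shows "\<forall>\<^sub>F \<epsilon> in at_right 0. \<exists>q v. degree q \<le> 2 * card B \<and>
    (\<forall>n<N. 0 \<le> v n \<and> (v n = 0 \<longleftrightarrow> n \<in> B) \<and> v n = poly q (real n) + \<epsilon> * \<tau> n * v (Suc n))"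
proof -
  have finB: "finite B" using B finite_subset by blast
  let ?q0 = "square_root_poly B"
  define g where "g n = (if n < N then poly ?q0 (real n) else 0)" for n
  \<comment> \<open>The subtracted sum interpolates the first term on \<open>B\<close>, so
    \<open>T v\<close> is 0 there and the fixed point keeps the zeros of \<open>g\<close>.\<close>
  define T where "T v n = (if n < N then \<tau> n * v (Suc n)
      - (\<Sum>b\<in>B. \<tau> b * v (Suc b) * poly (lagrange B b) (real n)) else 0)" for v n
  \<comment> \<open>A bound for \<open>T\<close> in the sup norm: 1 for the shifted term, the rest
    for the interpolant.\<close>
  define K where "K = 1 + (\<Sum>n<N. \<Sum>b\<in>B. \<bar>poly (lagrange B b) (real n)\<bar>)"
  define G where "G = (\<Sum>n<N. g n)"
  define \<delta> where "\<delta> = Min (insert 1 (g ` ({..<N} - B)))"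
  have g0: "0 \<le> g n" for n using square_root_poly(1)[OF finB] by (simp add: g_def)
  have gB: "g n = 0 \<longleftrightarrow> n \<in> B" if "n < N" for n
    using square_root_poly(2)[OF finB] that by (simp add: g_def)
  have G0: "0 \<le> G" unfolding G_def using g0 by (intro sum_nonneg) auto
  have G: "g n \<le> G" for n
  proof (cases "n < N")
    case True
    then show ?thesis unfolding G_def using g0 by (intro member_le_sum) auto
  next
    case False
    then show ?thesis using G0 by (simp add: g_def)
  qed
  have K1: "1 \<le> K" unfolding K_def by (simp add: sum_nonneg)
  have \<delta>: "0 < \<delta>" "\<delta> \<le> 1"
  proof -
    have "0 < g n" if "n < N" "n \<notin> B" for n using g0[of n] gB[OF that(1)] that(2) by linarith
    then show "0 < \<delta>" unfolding \<delta>_def by (subst Min_gr_iff) auto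
    show "\<delta> \<le> 1" unfolding \<delta>_def by (intro Min_le) auto
  qed
  have \<delta>_le: "\<delta> \<le> g n" if "n < N" "n \<notin> B" for n
    unfolding \<delta>_def using that by (intro Min_le) auto
  have Tbound: "\<bar>T v n\<bar> \<le> K * c" if v: "\<And>i. \<bar>v i\<bar> \<le> c" for v c n
  proof (cases "n < N")
    case True
    have c0: "0 \<le> c" using v[of 0] by linarith
    have t: "\<bar>\<tau> i * v j\<bar> \<le> c" for i j
      using mult_mono[OF \<tau>[of i] v[of j]] by (simp add: abs_mult)
    have "\<bar>\<tau> b * v (Suc b) * poly (lagrange B b) (real n)\<bar> \<le> c * \<bar>poly (lagrange B b) (real n)\<bar>" for b
      using mult_right_mono[OF t[of b "Suc b"], of "\<bar>poly (lagrange B b) (real n)\<bar>"] by (simp add: abs_mult)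
    then have "\<bar>\<Sum>b\<in>B. \<tau> b * v (Suc b) * poly (lagrange B b) (real n)\<bar>
        \<le> (\<Sum>b\<in>B. c * \<bar>poly (lagrange B b) (real n)\<bar>)"
      by (intro order.trans[OF sum_abs] sum_mono)
    also have "\<dots> = c * (\<Sum>b\<in>B. \<bar>poly (lagrange B b) (real n)\<bar>)" by (simp add: sum_distrib_left)
    also have "\<dots> \<le> c * (K - 1)"
      unfolding K_def using True c0
      by (intro mult_left_mono) (auto intro!: member_le_sum[of n "{..<N}" "\<lambda>n. \<Sum>b\<in>B. \<bar>poly (lagrange B b) (real n)\<bar>"] sum_nonneg)
    finally have "\<bar>\<Sum>b\<in>B. \<tau> b * v (Suc b) * poly (lagrange B b) (real n)\<bar> \<le> K * c - c"
      by (simp add: algebra_simps)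
    then show ?thesis unfolding T_def using True t[of n "Suc n"] by simp
  next
    case False
    then show ?thesis using v[of 0] K1 by (simp add: T_def)
  qed
  have Tdiff: "T v n - T w n = T (\<lambda>i. v i - w i) n" for v w n
    by (simp add: T_def algebra_simps sum_subtractf)
  \<comment> \<open>The threshold serves two purposes: \<open>\<epsilon> * K\<close> is at most 1/2,
    which makes the map a contraction, and a fixed point, being bounded by \<open>2 * G\<close>,
    differs from \<open>g\<close> by less than \<open>\<delta>\<close>, hence stays positive off
    \<open>B\<close>.\<close>
  have "\<forall>\<^sub>F \<epsilon> in at_right 0. \<epsilon> \<in> {0<..<\<delta> / (4 * K * (G + 1))}"
    using \<delta> K1 G0 by (intro eventually_at_right_real) auto
  then show ?thesis
  proof (rule eventually_mono)
    fix \<epsilon> assume \<epsilon>': "\<epsilon> \<in> {0<..<\<delta> / (4 * K * (G + 1))}"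
    have "0 < \<epsilon>" using \<epsilon>' by simp
    have \<epsilon>: "\<epsilon> * K * (4 * (G + 1)) < \<delta>"
      using \<epsilon>' K1 G0 by (simp add: pos_less_divide_eq mult_ac)
    have \<epsilon>K0: "0 \<le> \<epsilon> * K" using \<open>0 < \<epsilon>\<close> K1 by simp
    have \<epsilon>K: "\<epsilon> * K \<le> 1 / 2"
    proof -
      have "\<epsilon> * K * 4 \<le> \<epsilon> * K * (4 * (G + 1))" using \<epsilon>K0 G0 by (intro mult_left_mono) auto
      then show ?thesis using \<epsilon> \<delta>(2) by linarith
    qed
    have "\<exists>v. (\<lambda>n. g n + \<epsilon> * T v n) = v"
    proof (rule finite_support_contraction)
      show "g n + \<epsilon> * T v n = 0" if "N \<le> n" for v n using that by (simp add: g_def T_def)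
      fix v w :: "nat \<Rightarrow> real" and c n assume vw: "\<And>i. \<bar>v i - w i\<bar> \<le> c"
      have "0 \<le> c" using vw[of 0] by linarith
      have "\<bar>g n + \<epsilon> * T v n - (g n + \<epsilon> * T w n)\<bar> = \<epsilon> * \<bar>T (\<lambda>i. v i - w i) n\<bar>"
        using \<open>0 < \<epsilon>\<close> by (simp flip: Tdiff right_diff_distrib add: abs_mult)
      also have "\<dots> \<le> \<epsilon> * (K * c)" using Tbound[of "\<lambda>i. v i - w i" c] vw \<open>0 < \<epsilon>\<close> by simp
      also have "\<dots> \<le> c / 2" using mult_right_mono[OF \<epsilon>K \<open>0 \<le> c\<close>] by (simp add: mult.assoc)
      finally show "\<bar>g n + \<epsilon> * T v n - (g n + \<epsilon> * T w n)\<bar> \<le> c / 2" .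
    qed
    then obtain v where v: "v n = g n + \<epsilon> * T v n" for n by metis
    define c where "c = Max (insert 0 ((\<lambda>n. \<bar>v n\<bar>) ` {..<N}))"
    have c: "\<bar>v i\<bar> \<le> c" for i
    proof (cases "i < N")
      case True
      then show ?thesis unfolding c_def by (intro Max_ge) auto
    next
      case False
      then have "v i = 0" using v[of i] by (simp add: g_def T_def)
      then show ?thesis unfolding c_def by (simp add: Max_ge_iff)
    qed
    have \<epsilon>T: "\<bar>\<epsilon> * T v n\<bar> \<le> \<epsilon> * K * c" for n
      using mult_left_mono[OF Tbound[of v c n, OF c], of \<epsilon>] \<open>0 < \<epsilon>\<close> by (simp add: abs_mult mult.assoc)
    have c2: "c \<le> 2 * G"
    proof -
      have c0: "0 \<le> c" using c[of 0] by linarith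
      have "\<bar>v n\<bar> \<le> G + c / 2" for n
        using v[of n] \<epsilon>T[of n] G[of n] g0[of n] mult_right_mono[OF \<epsilon>K c0] by linarith
      then have "c \<le> G + c / 2" unfolding c_def using G0 c0
        by (subst Max_le_iff) (auto simp: c_def[symmetric])
      then show ?thesis by simp
    qed
    have "\<epsilon> * K * c \<le> \<epsilon> * K * (2 * G)" using c2 \<epsilon>K0 by (rule mult_left_mono)
    also have "\<dots> \<le> \<epsilon> * K * (4 * (G + 1))" using \<epsilon>K0 G0 by (intro mult_left_mono) auto
    finally have small: "\<epsilon> * K * c < \<delta>" using \<epsilon> by linarith
    \<comment> \<open>The correction has degree at most \<open>card B\<close>, so the degree bound
      of the unperturbed polynomial survives.\<close>
    let ?q = "?q0 + (\<Sum>b\<in>B. smult (- \<epsilon> * \<tau> b * v (Suc b)) (lagrange B b))"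
    have "degree ?q \<le> 2 * card B"
      using square_root_poly(3)[OF finB] by (intro degree_add_le degree_lagrange_sum finB) auto
    moreover have "v n = poly ?q (real n) + \<epsilon> * \<tau> n * v (Suc n)" if "n < N" for n
      using v[of n] that by (simp add: g_def T_def poly_sum sum_distrib_left sum_negf algebra_simps)
    moreover have "0 \<le> v n \<and> (v n = 0 \<longleftrightarrow> n \<in> B)" if n: "n < N" for n
    proof (cases "n \<in> B")
      case True
      have "(\<Sum>b\<in>B. \<tau> b * v (Suc b) * poly (lagrange B b) (real n)) = (\<Sum>b\<in>B. if b = n then \<tau> n * v (Suc n) else 0)"
        using True finB by (intro sum.cong) (auto simp: poly_lagrange)
      then have "T v n = 0" using True finB n by (simp add: T_def)
      then show ?thesis using v[of n] gB[OF n] True by simp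
    next
      case False
      then have "0 < v n" using v[of n] \<epsilon>T[of n] small \<delta>_le[OF n False] by linarith
      then show ?thesis using False by simp
    qed
    ultimately show "\<exists>q v. degree q \<le> 2 * card B \<and>
        (\<forall>n<N. 0 \<le> v n \<and> (v n = 0 \<longleftrightarrow> n \<in> B) \<and> v n = poly q (real n) + \<epsilon> * \<tau> n * v (Suc n))"
      by blast
  qed
qed

text \<open>The capacity of each segment depends on the position inside the next one, so that on the
  polytope the difference coordinates of all segments but the first are affine functions of
  the moments up to a small error.\<close>

locale chained = segmented +
  fixes \<epsilon> :: real
  assumes \<epsilon>_pos: "0 < \<epsilon>"
begin

text \<open>A chain relation that cancels a difference on segment \<open>j + 1\<close> puts twice
  its coefficient on segment \<open>j\<close>. With weights decreasing by the factor
  \<open>\<epsilon> / 2\<close>, this amounts to a relative error of size \<open>\<epsilon>\<close>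
  at every segment.\<close>

definition wt :: "nat \<Rightarrow> real" where
  "wt a = (if a < 2 * s then (\<epsilon> / 2) ^ (a div 2) else 1)"

definition \<gamma> :: "nat \<Rightarrow> nat \<Rightarrow> real" where
  "\<gamma> j a = (if Suc j < s then seg_diff (Suc j) a / 2 else 0)"

definition seg_sum :: "nat \<Rightarrow> nat \<Rightarrow> real" where
  "seg_sum j a = (if a div 2 = j then 1 else 0)"

lemma seg_below: "j < s \<Longrightarrow> 2 * j + 1 < ncoords ns"
  using block_below[of j ns "2 * j + 1"] block_seg[of j] s_le by simp

lemma sum_seg_diff_mult:
  assumes "finite I" "2 * j \<in> I" "2 * j + 1 \<in> I"
  shows "(\<Sum>a\<in>I. seg_diff j a * f a) = f (2 * j) - f (2 * j + 1)"
proof -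
  have "(\<Sum>a\<in>I. seg_diff j a * f a) = (\<Sum>a\<in>{2 * j, 2 * j + 1}. seg_diff j a * f a)"
    using assms by (intro sum.mono_neutral_right) (auto simp: seg_diff_def)
  then show ?thesis by (simp add: seg_diff_def)
qed

lemma cap_chain:
  "cap ns (\<lambda>_. 1) \<gamma> j z =
    (if Suc j < s then 1 + (crd z (2 * Suc j) - crd z (2 * Suc j + 1)) / 2 else 1)"
proof (cases "Suc j < s")
  case True
  have "(\<Sum>a\<in>{block_off ns (Suc j)..<ncoords ns}. \<gamma> j a * crd z a)
      = (\<Sum>a\<in>{block_off ns (Suc j)..<ncoords ns}. seg_diff (Suc j) a * (crd z a / 2))"
    using True by (intro sum.cong) (auto simp: \<gamma>_def)
  also have "\<dots> = crd z (2 * Suc j) / 2 - crd z (2 * Suc j + 1) / 2"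
    using seg_below[OF True] block_off_seg[of "Suc j"] True by (intro sum_seg_diff_mult) auto
  finally show ?thesis using True by (simp add: cap_def diff_divide_distrib)
qed (simp add: cap_def \<gamma>_def)

text \<open>Backwards along the chain: nonnegative coordinates with sum below 2 have half their
  difference in (-1,1), so the preceding capacity is again between 0 and 2. This is the reason for
  the factor 1/2 in \<open>\<gamma>\<close>.\<close>

lemma cap_bounds:
  assumes "solves_from ns (\<lambda>_. 1) \<gamma> (Suc j) z"
  shows "0 < cap ns (\<lambda>_. 1) \<gamma> j z \<and> cap ns (\<lambda>_. 1) \<gamma> j z < 2"
  using assms
proof (induction "s - j" arbitrary: j)
  case 0
  then show ?case by (simp add: cap_chain)
next
  case (Suc d)
  show ?case
  proof (cases "Suc j < s")
    case True
    define x y where "x = crd z (2 * Suc j)" and "y = crd z (2 * Suc j + 1)"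
    have "solves_from ns (\<lambda>_. 1) \<gamma> (Suc (Suc j)) z" using Suc.prems by (auto simp: solves_from_def)
    then have "cap ns (\<lambda>_. 1) \<gamma> (Suc j) z < 2" using Suc.hyps(1)[of "Suc j"] Suc.hyps(2) by simp
    moreover have "(\<Sum>a\<in>block ns (Suc j). crd z a) = cap ns (\<lambda>_. 1) \<gamma> (Suc j) z"
      using Suc.prems True s_le by (simp add: solves_from_def)
    ultimately have "x + y < 2" using block_seg[OF True] by (simp add: x_def y_def)
    moreover have "0 \<le> x" "0 \<le> y" using Suc.prems unfolding solves_from_def x_def y_def by blast+
    moreover have "cap ns (\<lambda>_. 1) \<gamma> j z = 1 + (x - y) / 2"
      using True by (simp only: cap_chain if_True x_def y_def)
    ultimately show ?thesis by (simp add: field_simps)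
  qed (simp add: cap_chain)
qed

sublocale deformed_product ns "\<lambda>_. 1" \<gamma>
  by unfold_locales (use cap_bounds in blast)

lemma ev_seg_diff: "j < s \<Longrightarrow> ev ns (seg_diff j) z = crd z (2 * j) - crd z (2 * j + 1)"
  unfolding ev_def using seg_below[of j] by (intro sum_seg_diff_mult) auto

lemma ev_seg_sum: "j < s \<Longrightarrow> ev ns (seg_sum j) z = crd z (2 * j) + crd z (2 * j + 1)"
proof -
  assume j: "j < s"
  have "ev ns (seg_sum j) z = (\<Sum>a\<in>{2 * j, 2 * j + 1}. seg_sum j a * crd z a)"
    unfolding ev_def using seg_below[OF j] by (intro sum.mono_neutral_right) (auto simp: seg_sum_def)
  then show ?thesis by (simp add: seg_sum_def)
qed

definition functionals :: "nat \<Rightarrow> (nat \<Rightarrow> real) set" where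
  "functionals m = insert (seg_diff 0) ((\<lambda>l. mom wt (monom 1 l)) ` {..m})"

lemma finite_functionals: "finite (functionals m)"
  by (simp add: functionals_def)

lemma card_functionals: "card (functionals m) \<le> m + 2"
proof -
  have "card (functionals m) \<le> Suc (card ((\<lambda>l. mom wt (monom 1 l)) ` {..m}))"
    unfolding functionals_def by (rule card_insert_le_m1) auto
  also have "\<dots> \<le> Suc (card {..m})" by (intro Suc_le_mono[THEN iffD2] card_image_le) simp
  finally show ?thesis by simp
qed

lemma affine_rep_mom:
  assumes "degree q \<le> m"
  shows "affine_rep (functionals m) (mom wt q)"
proof -
  have "mom wt q a = (\<Sum>l\<le>m. coeff q l * mom wt (monom 1 l) a)" for a
  proof -
    have "poly q x = (\<Sum>l\<le>m. coeff q l * x ^ l)" for x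
      unfolding poly_altdef using assms by (intro sum.mono_neutral_left) (auto simp: coeff_eq_0)
    then show ?thesis by (simp add: mom_def poly_monom sum_distrib_left mult.left_commute)
  qed
  then have "mom wt q = (\<lambda>a. \<Sum>l\<le>m. coeff q l * mom wt (monom 1 l) a)" by blast
  then show ?thesis
    by (simp only:) (intro affine_rep_sum affine_rep_scale affine_rep_base finite_functionals,
      auto simp: functionals_def)
qed

text \<open>This is the block equation of segment \<open>j\<close>, doubled. It trades the
  difference of segment \<open>j + 1\<close> for the sum of segment \<open>j\<close> at no cost in
  functionals.\<close>

lemma affine_rep_chain:
  assumes "Suc j < s"
  shows "affine_rep \<F> (\<lambda>a. 2 * seg_sum j a + (-1) * seg_diff (Suc j) a)"
proof (rule affine_rep_const)
  fix z assume z: "z \<in> Q"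
  have "ev ns (seg_sum j) z = (\<Sum>a\<in>block ns j. crd z a)"
    using ev_seg_sum[of j z] block_seg[of j] assms by simp
  also have "\<dots> = 1 + ev ns (seg_diff (Suc j)) z / 2"
    using Q_sum[OF z, of j] cap_chain[of j z] ev_seg_diff[OF assms, of z] assms s_le by simp
  finally show "ev ns (\<lambda>a. 2 * seg_sum j a + (-1) * seg_diff (Suc j) a) z = 2"
    unfolding ev_add ev_scale by simp
qed

theorem delta_pr_le:
  assumes s0: "0 < s"
    and ex: "\<And>A. A \<in> transversals ns \<Longrightarrow> \<exists>q v. degree q \<le> 2 * card (zero_pts A) \<and>
      (\<forall>n<ncoords ns - s. 0 \<le> v n \<and> (v n = 0 \<longleftrightarrow> n \<in> zero_pts A) \<and>
        v n = poly q (real n) + \<epsilon> * (if Suc n < s then seg_sign A (Suc n) else 0) * v (Suc n))"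
  shows "delta_pr k ns \<le> 2 * (k + (length ns - s)) + 2"
proof -
  let ?m = "2 * (k + (length ns - s))"
  obtain p where p: "s = Suc p" using s0 by (cases s) auto
  have "delta_pr k ns \<le> card (functionals ?m)"
  proof (rule delta_pr_le_card[OF finite_functionals])
    fix A assume A: "A \<in> transversals ns" "card A \<le> k + length ns"
    obtain q v where q: "degree q \<le> 2 * card (zero_pts A)"
      and v: "\<And>n. n < ncoords ns - s \<Longrightarrow> 0 \<le> v n \<and> (v n = 0 \<longleftrightarrow> n \<in> zero_pts A)"
      and vq: "\<And>n. n < ncoords ns - s \<Longrightarrow>
        v n = poly q (real n) + \<epsilon> * (if Suc n < s then seg_sign A (Suc n) else 0) * v (Suc n)"
      using ex[OF A(1)] by blast
    have deg: "degree q \<le> ?m"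
      by (rule order.trans[OF q mult_le_mono2[OF card_zero_pts[OF A]]])
    define w where "w j = (\<epsilon> / 2) ^ j * v j" for j
    define c where "c j = seg_sign A j * w j" for j
    \<comment> \<open>Each chain relation supplies the wanted term
      \<open>- c (Suc j) * seg_diff (Suc j) a\<close> and adds \<open>2 * c (Suc j)\<close> on
      segment \<open>j\<close>. There the equation for \<open>v\<close>, multiplied by
      \<open>(\<epsilon> / 2) ^ j\<close>, says that the polynomial part and this addition make up
      exactly \<open>w j\<close>.\<close>
    define h where "h a = mom wt q a
      + (\<Sum>j<p. c (Suc j) * (2 * seg_sum j a + (-1) * seg_diff (Suc j) a)) + (- c 0) * seg_diff 0 a" for a
    have "affine_rep (functionals ?m)
        (\<lambda>a. \<Sum>j<p. c (Suc j) * (2 * seg_sum j a + (-1) * seg_diff (Suc j) a))"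
      using p by (intro affine_rep_sum affine_rep_scale affine_rep_chain) simp
    moreover have "affine_rep (functionals ?m) (seg_diff 0)"
      by (intro affine_rep_base finite_functionals) (simp add: functionals_def)
    ultimately have "affine_rep (functionals ?m) h"
      unfolding h_def by (intro affine_rep_add affine_rep_mom[OF deg] affine_rep_scale)
    moreover have "0 \<le> h a \<and> (h a = 0 \<longleftrightarrow> a \<in> A)" if a: "a < ncoords ns" for a
    proof -
      have h: "h a = mom wt q a + (if a div 2 < p then 2 * c (Suc (a div 2)) else 0) - (\<Sum>j<s. c j * seg_diff j a)"
      proof -
        have "(\<Sum>j<p. c (Suc j) * (2 * seg_sum j a)) = (\<Sum>j<p. if j = a div 2 then 2 * c (Suc j) else 0)"
          by (rule sum.cong) (auto simp: seg_sum_def)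
        then show ?thesis
          unfolding h_def p sum.lessThan_Suc_shift
          by (simp add: right_diff_distrib sum_subtractf)
      qed
      show ?thesis
      proof (cases "a < 2 * s")
        case True
        let ?j = "a div 2"
        have j: "?j < s" "a \<in> {2 * ?j, 2 * ?j + 1}" using True by auto
        have jN: "?j < ncoords ns - s" using seg_below[of p] p j(1) by simp
        have "mom wt q a = (\<epsilon> / 2) ^ ?j * poly q (real ?j)"
          using True by (simp add: mom_def wt_def pt_small)
        moreover have "?j < p \<longleftrightarrow> Suc ?j < s" using p by simp
        ultimately have "w ?j = mom wt q a + (if ?j < p then 2 * c (Suc ?j) else 0)"
          unfolding w_def vq[OF jN] by (simp add: c_def w_def field_simps)
        then have ha: "h a = w ?j * (1 - seg_sign A ?j * seg_diff ?j a)"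
          unfolding h sum_seg_diff[OF j] by (simp add: c_def algebra_simps)
        have "0 \<le> w ?j" "w ?j = 0 \<longleftrightarrow> ?j \<in> zero_pts A"
          using v[OF jN] \<epsilon>_pos by (auto simp: w_def)
        then show ?thesis unfolding ha using seg_value[OF A(1) j(1) _ _ j(2)] by blast
      next
        case False
        then have "\<not> a div 2 < p" using p by simp
        then have ha: "h a = poly q (real (pt a))"
          unfolding h using False by (simp add: sum_seg_diff_big mom_def wt_def)
        have ptN: "pt a < ncoords ns - s" "\<not> Suc (pt a) < s" using False a by (auto simp: pt_big)
        then have "v (pt a) = h a" unfolding ha using vq[OF ptN(1)] by simp
        then show ?thesis using v[OF ptN(1)] zero_pts_big[of a A] False by simp
      qed
    qed
    ultimately show "\<exists>h. (\<forall>a<ncoords ns. 0 \<le> h a \<and> (h a = 0 \<longleftrightarrow> a \<in> A)) \<and> affine_rep (functionals ?m) h"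
      by blast
  qed
  then show ?thesis using card_functionals[of ?m] by linarith
qed

end

context segmented
begin

lemma zero_pts_subset:
  assumes "A \<in> transversals ns"
  shows "zero_pts A \<subseteq> {..<ncoords ns - s}"
proof -
  have "2 * s \<le> ncoords ns" using block_off_mono[OF s_le, of ns] block_off_seg[of s] by simp
  then show ?thesis using assms by (auto simp: zero_pts_def transversals_def pt_big)
qed

text \<open>The weights of the projection contain \<open>\<epsilon>\<close>, so it has to be fixed
  before \<open>A\<close> is known. Every transversal accepts all sufficiently small values, and
  there are finitely many transversals.\<close>

lemma delta_pr_le_chained:
  assumes "0 < s"
  shows "delta_pr k ns \<le> 2 * (k + (length ns - s)) + 2"
proof -
  let ?P = "\<lambda>A \<epsilon>. \<exists>q v. degree q \<le> 2 * card (zero_pts A) \<and>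
      (\<forall>n<ncoords ns - s. 0 \<le> v n \<and> (v n = 0 \<longleftrightarrow> n \<in> zero_pts A) \<and>
        v n = poly q (real n) + \<epsilon> * (if Suc n < s then seg_sign A (Suc n) else 0) * v (Suc n))"
  have "finite (transversals ns)"
    by (rule finite_subset[of _ "Pow {..<ncoords ns}"]) (auto simp: transversals_def)
  moreover have "\<forall>\<^sub>F \<epsilon> in at_right 0. ?P A \<epsilon>" if "A \<in> transversals ns" for A
    by (rule perturbed_square_root_poly[OF zero_pts_subset[OF that]]) (auto simp: seg_sign_def)
  ultimately have "\<forall>\<^sub>F \<epsilon> in at_right 0. \<forall>A\<in>transversals ns. ?P A \<epsilon>"
    by (simp add: eventually_ball_finite_distrib)
  moreover have "\<forall>\<^sub>F \<epsilon>::real in at_right 0. 0 < \<epsilon>" by (rule eventually_at_right_less)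
  ultimately have "\<forall>\<^sub>F \<epsilon> in at_right 0. 0 < \<epsilon> \<and> (\<forall>A\<in>transversals ns. ?P A \<epsilon>)"
    by (rule eventually_conj[rotated])
  then obtain \<epsilon> where \<epsilon>: "0 < \<epsilon>" "\<forall>A\<in>transversals ns. ?P A \<epsilon>"
    using eventually_happens'[OF trivial_limit_at_right_real] by blast
  interpret chained ns s \<epsilon> by unfold_locales (rule \<epsilon>(1))
  show ?thesis using \<epsilon>(2) by (intro delta_pr_le assms) blast
qed

end

section \<open>Choice of \<open>t\<close> and the three ranges of \<open>s\<close>\<close>

theorem theorem3p6:
  fixes k s :: nat and ns :: "nat list"
  assumes "s \<le> length ns"
    and "\<forall>i<s. ns ! i = 1"
    and "\<forall>i. s \<le> i \<and> i < length ns \<longrightarrow> 1 < ns ! i"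
    and "sorted ns"
  shows "let r = length ns;
             t = (GREATEST t. s \<le> t \<and> t \<le> r \<and>
                    3 * s + (\<Sum>i\<in>{s..<t}. ns ! i + 1) \<le> 2 * k + 2 * r)
         in (3 * s \<le> 2 * k + 2 * r \<longrightarrow>
               int (delta_pr k ns) \<le> 2 * (int k + int r) - int s - int t)
          \<and> (3 * s = 2 * k + 2 * r + 1 \<longrightarrow>
               int (delta_pr k ns) \<le> 2 * (int k + int r - int s) + 1)
          \<and> (3 * s \<ge> 2 * k + 2 * r + 2 \<longrightarrow>
               int (delta_pr k ns) \<le> 2 * (int k + int r - int s + 1))"
proof -
  interpret segmented ns s using assms(1,2) by unfold_locales auto
  let ?r = "length ns"
  define ok where "ok t \<longleftrightarrow> s \<le> t \<and> t \<le> ?r \<and> 3 * s + (\<Sum>i\<in>{s..<t}. ns ! i + 1) \<le> 2 * k + 2 * ?r" for t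
  have off: "block_off ns t = 2 * s + (\<Sum>i\<in>{s..<t}. ns ! i + 1)" if "s \<le> t" "t \<le> ?r" for t
    using that
  proof (induction t rule: dec_induct)
    case (step t)
    then show ?case by (simp add: block_off_Suc)
  qed (simp add: block_off_seg)
  have 1: "int (delta_pr k ns) \<le> 2 * (int k + int ?r) - int s - int (Greatest ok)"
    if "3 * s \<le> 2 * k + 2 * ?r"
  proof -
    have "ok s" using that assms(1) by (simp add: ok_def)
    then have t: "ok (Greatest ok)" by (rule GreatestI_nat[where b = ?r]) (auto simp: ok_def)
    define t where "t = Greatest ok"
    interpret interpolated ns s t using t by unfold_locales (auto simp: ok_def t_def)
    have "npts = s + (\<Sum>i\<in>{s..<t}. ns ! i + 1)" using off[OF s_le_t t_le] by (simp add: npts_def)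
    moreover have "3 * s + (\<Sum>i\<in>{s..<t}. ns ! i + 1) \<le> 2 * k + 2 * ?r" using t by (simp only: ok_def t_def)
    moreover obtain d where "?r = s + d" using s_le le_Suc_ex by blast
    \<comment> \<open>Subtracting \<open>2 * s\<close> on both sides turns the inequality that
      selects \<open>t\<close> into the degree bound on the number of interpolation points.\<close>
    ultimately have n: "npts \<le> 2 * (k + (?r - s))" by simp
    have "delta_pr k ns \<le> s + (npts - t) + (2 * (k + (?r - s)) - npts)" using n by (intro delta_pr_le) simp
    then show ?thesis using n card_nonbase(1) s_le by (simp add: t_def[symmetric])
  qed
  have 2: "int (delta_pr k ns) \<le> 2 * (int k + int ?r - int s) + 1" if "3 * s = 2 * k + 2 * ?r + 1"
  proof -
    \<comment> \<open>Only the segments are interpolated. Their number exceeds the degree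
      \<open>2 * (k + (?r - s))\<close> by exactly one, the borderline of interpolation, so the
      truncated difference in the bound is 0 and \<open>s\<close> functionals remain.\<close>
    interpret interpolated ns s s by unfold_locales (simp_all add: s_le)
    have "npts = s" using off[OF order_refl s_le] by (simp add: npts_def)
    then have "delta_pr k ns \<le> s + (s - s) + (2 * (k + (?r - s)) - s)"
      using delta_pr_le[of k] that by simp
    then show ?thesis using that s_le by simp
  qed
  have 3: "int (delta_pr k ns) \<le> 2 * (int k + int ?r - int s + 1)" if "3 * s \<ge> 2 * k + 2 * ?r + 2"
    using delta_pr_le_chained[of k] that s_le by simp
  show ?thesis using 1 2 3 by (simp add: Let_def ok_def[abs_def])
qed

end
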